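(* Let $\delta>0$ be fixed, sufficiently small, and let $\bar s,\bar r>0$ be constants such that, for all sufficiently large $L$, every stationary probability measure $\nu^-$ of the inverse projective process satisfies $\nu^-\{(x,y,\theta):\theta\notin B_{L^{-\bar s}}(\frac\pi2)\}\le L^{-\bar r}$ (such constants exist). Then, for all sufficiently large $L$, $$(\mathbb P\otimes m)\Bigl\{(\omega,x,y):\operatorname{dist}\bigl(e^s(\omega,x,y),\tfrac\pi2\bigr)\ge L^{-\bar s}\Bigr\}\le L^{-\bar r}.$$ Consequently, for $(\mathbb P\otimes m)$-almost every $(\omega,x,y)$, $$\limsup_{n\to\infty}\frac{\left|\left\{1\le k\le n:\operatorname{dist}\bigl(e^s(\Theta^k(\omega,x,y)),\tfrac\pi2\bigr)\ge L^{-\bar s}\right\}\right|}{n}\le L^{-\bar r},$$ where $\Theta:\Omega\times\mathbb T^2\to\Omega\times\mathbb T^2$ is the skew product $\Theta(\omega,x,y)=(\vartheta\omega,f_\omega(x,y))$.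
   Context: For $L>0$ and $\delta>0$ put $\sigma:=L^{-\delta}$ and $f(x):=L\cos(2\pi x)$. Let $\Omega:=[-\sigma,\sigma]^{\mathbb N_0}$ with the product probability measure $\mathbb P$ whose coordinate marginals are uniform on $[-\sigma,\sigma]$, and $\vartheta$ the left shift on $\Omega$. For $\omega\in\Omega$, $f_\omega(x,y)=f_{\omega_0}(x,y)=(f(x+\omega_0)-y,\;x+\omega_0)\pmod1$ on $\mathbb T^2$. $m$ is normalized Lebesgue measure on $\mathbb T^2$, $\mathbb{PT}^2\simeq\mathbb T^2\times\mathbb P^1$. A direction in $\mathbb P^1$ is represented by the angle $\theta\in[0,\pi)$ with $v=(\cos\theta,\sin\theta)$ up to sign; $\operatorname{dist}$ and the balls $B_r(\cdot)$ are with respect to the angular distance on $\mathbb P^1$. The inverse projective process is the Markov chain on $\mathbb{PT}^2$ induced by $f_{\omega_i}^{-1}$: $x_{i+1}=y_i-\omega_i$, $y_{i+1}=f(y_i)-x_i$ (mod 1), $\tan\theta_{i+1}=f'(y_i)-\cot\theta_i$. In this regime ($L$ large) the top Lyapunov exponent of the random standard map is positive and the maps preserve area; $e^s(\omega,x,y)\in\mathbb P^1$ denotes the $(\mathbb P\otimes m)$-almost surely defined Oseledets stable direction of the cocycle $Df_\omega^n(x,y)$, $n\ge0$, where $f_\omega^n=f_{\omega_{n-1}}\circ\cdots\circ f_{\omega_0}$. *)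

theory Defs
  imports "HOL-Probability.Probability"
begin

definition noise_width :: "real \<Rightarrow> real \<Rightarrow> real" where
  "noise_width L \<delta> = L powr (- \<delta>)"

definition std_f :: "real \<Rightarrow> real \<Rightarrow> real" where
  "std_f L x = L * cos (2 * pi * x)"

definition noise :: "real \<Rightarrow> real \<Rightarrow> real measure" where
  "noise L \<delta> =
     (let I = {- noise_width L \<delta> .. noise_width L \<delta>}
      in restrict_space (uniform_measure lborel I) I)"

definition noise_seq :: "real \<Rightarrow> real \<Rightarrow> (nat \<Rightarrow> real) measure" where
  "noise_seq L \<delta> = PiM UNIV (\<lambda>_. noise L \<delta>)"

text \<open>
  The torus is represented by its fundamental domain with the Borel sets of the plane, on which
  Lebesgue measure is already normalized. Only its measurable structure is used; derivatives of
  torus maps are taken on their lifts to the plane.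
\<close>

definition torus :: "(real \<times> real) set" where
  "torus = {0..<1} \<times> {0..<1}"

definition torus_measure :: "(real \<times> real) measure" where
  "torus_measure = restrict_space lborel torus"

definition mod1 :: "real \<times> real \<Rightarrow> real \<times> real" where
  "mod1 = (\<lambda>(x, y). (frac x, frac y))"

definition std_lift :: "real \<Rightarrow> real \<Rightarrow> real \<times> real \<Rightarrow> real \<times> real" where
  "std_lift L w = (\<lambda>(x, y). (std_f L (x + w) - y, x + w))"

definition std_map :: "real \<Rightarrow> real \<Rightarrow> real \<times> real \<Rightarrow> real \<times> real" where
  "std_map L w z = mod1 (std_lift L w z)"

primrec lift_iter :: "real \<Rightarrow> (nat \<Rightarrow> real) \<Rightarrow> nat \<Rightarrow> real \<times> real \<Rightarrow> real \<times> real" where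
  "lift_iter L \<omega> 0 = id"
| "lift_iter L \<omega> (Suc n) = std_lift L (\<omega> n) \<circ> lift_iter L \<omega> n"

definition cocycle :: "real \<Rightarrow> (nat \<Rightarrow> real) \<Rightarrow> nat \<Rightarrow> real \<times> real \<Rightarrow> real \<times> real \<Rightarrow> real \<times> real" where
  "cocycle L \<omega> n z = frechet_derivative (lift_iter L \<omega> n) (at z)"

definition skew :: "real \<Rightarrow> (nat \<Rightarrow> real) \<times> (real \<times> real) \<Rightarrow> (nat \<Rightarrow> real) \<times> (real \<times> real)" where
  "skew L = (\<lambda>(\<omega>, z). (\<lambda>n. \<omega> (Suc n), std_map L (\<omega> 0) z))"

text \<open>
  The projective line is the set of angles \<open>[0, \<pi>)\<close>. Its Borel sets are those of the
  interval, although its topology is that of the circle obtained by gluing the end points.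
\<close>

definition proj_line :: "real set" where
  "proj_line = {0..<pi}"

definition unit_vec :: "real \<Rightarrow> real \<times> real" where
  "unit_vec \<theta> = (cos \<theta>, sin \<theta>)"

definition direction :: "real \<times> real \<Rightarrow> real" where
  "direction v = (THE \<theta>. \<theta> \<in> proj_line \<and> (\<exists>c. v = c *\<^sub>R unit_vec \<theta>))"

definition ang_dist :: "real \<Rightarrow> real \<Rightarrow> real" where
  "ang_dist \<theta> \<theta>' = min \<bar>\<theta> - \<theta>'\<bar> (pi - \<bar>\<theta> - \<theta>'\<bar>)"

definition proj_ball :: "real \<Rightarrow> real \<Rightarrow> real set" where
  "proj_ball \<theta> r = {\<theta>' \<in> proj_line. ang_dist \<theta>' \<theta> < r}"

definition proj_line_space :: "real measure" where
  "proj_line_space = restrict_space borel proj_line"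

definition proj_bundle :: "((real \<times> real) \<times> real) measure" where
  "proj_bundle = restrict_space borel torus \<Otimes>\<^sub>M proj_line_space"

definition inv_lift :: "real \<Rightarrow> real \<Rightarrow> real \<times> real \<Rightarrow> real \<times> real" where
  "inv_lift L w = (\<lambda>(x, y). (y - w, std_f L y - x))"

definition inv_proj_step ::
  "real \<Rightarrow> real \<Rightarrow> (real \<times> real) \<times> real \<Rightarrow> (real \<times> real) \<times> real" where
  "inv_proj_step L w = (\<lambda>(z, \<theta>).
     (mod1 (inv_lift L w z),
      direction (frechet_derivative (inv_lift L w) (at z) (unit_vec \<theta>))))"

definition inv_proj_kernel ::
  "real \<Rightarrow> real \<Rightarrow> (real \<times> real) \<times> real \<Rightarrow> ((real \<times> real) \<times> real) measure" where
  "inv_proj_kernel L \<delta> p = distr (noise L \<delta>) proj_bundle (\<lambda>w. inv_proj_step L w p)"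

definition stationary :: "real \<Rightarrow> real \<Rightarrow> ((real \<times> real) \<times> real) measure \<Rightarrow> bool" where
  "stationary L \<delta> \<nu> \<longleftrightarrow>
     prob_space \<nu> \<and> sets \<nu> = sets proj_bundle \<and>
     (\<forall>A \<in> sets proj_bundle. emeasure \<nu> A = (\<integral>\<^sup>+ p. emeasure (inv_proj_kernel L \<delta> p) A \<partial>\<nu>))"

text \<open>
  The maps preserve area, so a positive top exponent \<open>l\<close> forces the second exponent to be
  \<open>- l\<close>, and at most one direction satisfies the following condition.
\<close>

definition stable_at :: "real \<Rightarrow> (nat \<Rightarrow> real) \<Rightarrow> real \<times> real \<Rightarrow> real \<Rightarrow> bool" where
  "stable_at L \<omega> z \<theta> \<longleftrightarrow>
     \<theta> \<in> proj_line \<and>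
     (\<exists>l > 0. (\<lambda>n. ln (onorm (cocycle L \<omega> n z)) / real n) \<longlonglongrightarrow> l \<and>
              (\<lambda>n. ln (norm (cocycle L \<omega> n z (unit_vec \<theta>))) / real n) \<longlonglongrightarrow> - l)"

text \<open>
  The stable direction is only defined almost surely; \<open>es\<close> is any measurable version of it.
\<close>

definition oseledets_stable ::
  "real \<Rightarrow> real \<Rightarrow> ((nat \<Rightarrow> real) \<times> (real \<times> real) \<Rightarrow> real) \<Rightarrow> bool" where
  "oseledets_stable L \<delta> es \<longleftrightarrow>
     es \<in> (noise_seq L \<delta> \<Otimes>\<^sub>M torus_measure) \<rightarrow>\<^sub>M proj_line_space \<and>
     (AE (\<omega>, z) in noise_seq L \<delta> \<Otimes>\<^sub>M torus_measure. stable_at L \<omega> z (es (\<omega>, z)))"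

definition stationary_bound :: "real \<Rightarrow> real \<Rightarrow> real \<Rightarrow> bool" where
  "stationary_bound \<delta> s r \<longleftrightarrow>
     (\<forall>\<^sub>F L in at_top. \<forall>\<nu>. stationary L \<delta> \<nu> \<longrightarrow>
        measure \<nu> {p \<in> space \<nu>. snd p \<notin> proj_ball (pi / 2) (L powr (- s))} \<le> L powr (- r))"

lemma inv_lift_std_lift: "inv_lift L w (std_lift L w z) = z" "std_lift L w (inv_lift L w z) = z"
  by (auto simp: inv_lift_def std_lift_def split: prod.splits)

lemma has_derivative_inv_lift:
  "(inv_lift L w has_derivative (\<lambda>(h, k). (k, deriv (std_f L) y * k - h))) (at (x, y))"
proof -
  have f: "(std_f L has_field_derivative - 2 * pi * L * sin (2 * pi * t)) (at t)" for t
    unfolding std_f_def by (auto intro!: derivative_eq_intros)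
  then have d: "deriv (std_f L) y = - 2 * pi * L * sin (2 * pi * y)"
    by (rule DERIV_imp_deriv)
  show ?thesis
    unfolding inv_lift_def case_prod_unfold d std_f_def
    by (auto intro!: derivative_eq_intros simp: fun_eq_iff)
qed

lemma direction_unique:
  assumes "\<theta> \<in> proj_line" "v = c *\<^sub>R unit_vec \<theta>" "v \<noteq> 0"
  shows "direction v = \<theta>"
  unfolding direction_def
proof (rule the_equality)
  show "\<theta> \<in> proj_line \<and> (\<exists>c. v = c *\<^sub>R unit_vec \<theta>)" using assms by blast
  fix t assume t: "t \<in> proj_line \<and> (\<exists>c. v = c *\<^sub>R unit_vec t)"
  then obtain d where d: "v = d *\<^sub>R unit_vec t" by blast
  have c0: "c \<noteq> 0" "d \<noteq> 0" using assms d by auto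
  have e: "c * cos \<theta> = d * cos t" "c * sin \<theta> = d * sin t"
    using assms d by (auto simp: unit_vec_def)
  have "c * d * sin (\<theta> - t) = (c * sin \<theta>) * (d * cos t) - (c * cos \<theta>) * (d * sin t)"
    by (simp add: sin_diff algebra_simps)
  also have "\<dots> = 0" using e by simp
  finally have s: "sin (\<theta> - t) = 0" using c0 by simp
  have "\<bar>\<theta> - t\<bar> < pi" using t assms(1) by (auto simp: proj_line_def)
  then have "\<theta> - t = 0" using s sin_eq_0_pi[of "\<theta> - t"] by linarith
  then show "t = \<theta>" by simp
qed

lemma tan_inv_proj_step:
  assumes "\<theta> \<in> {0<..<pi}"
  shows "tan (snd (inv_proj_step L w ((x, y), \<theta>))) = deriv (std_f L) y - cot \<theta>"
proof -
  define a where "a = deriv (std_f L) y - cot \<theta>"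
  define t where "t = (if a \<ge> 0 then arctan a else arctan a + pi)"
  have s: "sin \<theta> > 0" using assms by (auto intro: sin_gt_zero)
  have tn: "tan t = a" by (simp add: t_def tan_arctan)
  have c: "cos t \<noteq> 0" by (auto simp: t_def)
  have tp: "t \<in> proj_line"
    using arctan_bounded[of a] pi_gt_zero by (auto simp: t_def proj_line_def)
  have "frechet_derivative (inv_lift L w) (at (x, y)) (unit_vec \<theta>)
      = (sin \<theta>, deriv (std_f L) y * sin \<theta> - cos \<theta>)"
    using frechet_derivative_at[OF has_derivative_inv_lift[of L w y x], symmetric]
    by (simp add: unit_vec_def)
  also have "\<dots> = (sin \<theta> / cos t) *\<^sub>R unit_vec t"
  proof -
    have "sin t = a * cos t" using tn c by (simp add: tan_def field_simps)
    then show ?thesis using s c by (simp add: unit_vec_def a_def cot_def field_simps)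
  qed
  finally have v: "frechet_derivative (inv_lift L w) (at (x, y)) (unit_vec \<theta>)
      = (sin \<theta> / cos t) *\<^sub>R unit_vec t" .
  have "fst ((sin \<theta> / cos t) *\<^sub>R unit_vec t) \<noteq> 0"
    using s c by (simp add: unit_vec_def)
  then have "(sin \<theta> / cos t) *\<^sub>R unit_vec t \<noteq> 0" by (metis fst_zero)
  then have "direction (frechet_derivative (inv_lift L w) (at (x, y)) (unit_vec \<theta>)) = t"
    unfolding v by (intro direction_unique[OF tp refl])
  then show ?thesis using tn by (simp add: inv_proj_step_def a_def)
qed

lemma inv_proj_step_zero: "snd (inv_proj_step L w ((x, y), 0)) = pi / 2"
proof -
  have "frechet_derivative (inv_lift L w) (at (x, y)) (unit_vec 0) = (-1) *\<^sub>R unit_vec (pi / 2)"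
    using frechet_derivative_at[OF has_derivative_inv_lift[of L w y x], symmetric]
    by (simp add: unit_vec_def)
  moreover have "snd ((-1) *\<^sub>R unit_vec (pi / 2)) \<noteq> 0" by (simp add: unit_vec_def)
  then have "(-1) *\<^sub>R unit_vec (pi / 2) \<noteq> 0" by (metis snd_zero)
  moreover have "pi / 2 \<in> proj_line" by (simp add: proj_line_def)
  ultimately have "direction (frechet_derivative (inv_lift L w) (at (x, y)) (unit_vec 0)) = pi / 2"
    by (metis direction_unique)
  then show ?thesis by (simp add: inv_proj_step_def)
qed

end

theory Submission
  imports Defs
begin

text \<open>
  The noise \<open>\<omega>\<^sub>0\<close> is independent of \<open>\<Theta>(\<omega>, z)\<close>, and the inverse step with noise \<open>\<omega>\<^sub>0\<close> carries the
  stable direction over \<open>\<Theta>(\<omega>, z)\<close> to the one over \<open>(\<omega>, z)\<close>. Hence the law of \<open>(z, e\<^sup>s(\<omega>, z))\<close>, even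
  conditioned on a \<open>\<Theta>\<close>-invariant event, is stationary for the inverse projective process, and the
  assumed bound for stationary measures holds on every invariant event. Applied to the events
  \<open>limsup > c\<close> together with the maximal ergodic inequality, this gives the almost sure bound
  on the frequencies without any appeal to ergodicity.

  Constants \<open>s\<close> and \<open>r\<close> exist because three inverse steps already spread out \<open>f'(y\<^sub>2)\<close> on the scale
  \<open>L\<close>, independently of \<open>\<theta>\<^sub>2\<close>.
\<close>

section \<open>Maximal ergodic inequality\<close>

text \<open>The stable direction depends on the noises ahead, so along the forward orbit it is not
  driven by fresh noise; read backwards it is. The independence rests on area preservation: whatever
  the value of \<open>\<omega>\<^sub>0\<close>, a uniform point has a uniform image, so the image
  carries no trace of it. Area preservation in turn is reduced to rotations and reflections of one
  circle coordinate.

  That the inverse step carries one stable direction to the other is a uniqueness statement: a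
  pulled back direction has a bounded forward orbit, and two directions with bounded orbits would
  contradict the growth of the operator norm.

  Invariant events matter because an ergodic average converges to a conditional expectation given
  exactly these events, so a bound on each of them is a bound on the limit.

  For the existence of \<open>s\<close> and \<open>r\<close>, three is the first number of steps at
  which noise reaches the angle: \<open>w0\<close> shifts \<open>x1\<close>, then \<open>x1\<close>
  enters \<open>y2\<close>, and only \<open>y2\<close> enters the slope of the third angle.\<close>

lemma maximal_ergodic:
  fixes f :: "'a \<Rightarrow> real"
  assumes T [measurable]: "T \<in> M \<rightarrow>\<^sub>M M" and pres: "distr M M T = M" and f: "integrable M f"
  defines "A \<equiv> {x \<in> space M. \<exists>n. (\<Sum>k<n. f ((T ^^ k) x)) > 0}"
  shows "0 \<le> (\<integral>x. indicator A x * f x \<partial>M)"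
proof -
  note [measurable] = borel_measurable_integrable[OF f]
  \<comment> \<open>Garsia's argument: \<open>m n x\<close> is the maximum of the orbit sums of
    length at most \<open>n\<close>, the empty sum included. The recursive form yields
    \<open>f = m (Suc n) - m n \<circ> T\<close> wherever \<open>m (Suc n)\<close> is
    positive.\<close>
  define m where "m = rec_nat (\<lambda>_. 0) (\<lambda>_ g x. max 0 (f x + g (T x)))"
  have m0: "m 0 x = 0" and mS: "m (Suc n) x = max 0 (f x + m n (T x))" for n x
    by (simp_all add: m_def)
  have m_nonneg: "0 \<le> m n x" for n x by (cases n) (simp_all add: m0 mS)
  have m_mono: "m n x \<le> m (Suc n) x" for n x
  proof (induction n arbitrary: x)
    case 0 then show ?case by (simp add: m0 m_nonneg)
  next
    case (Suc n) show ?case unfolding mS[of "Suc n"] mS[of n x] using Suc[of "T x"] by linarith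
  qed
  have int_T: "integrable M (\<lambda>x. g (T x))" "(\<integral>x. g (T x) \<partial>M) = (\<integral>x. g x \<partial>M)" if g: "integrable M g" for g :: "'a \<Rightarrow> real"
  proof -
    note [measurable] = borel_measurable_integrable[OF g]
    show "integrable M (\<lambda>x. g (T x))"
      using g integrable_distr_eq[OF T, of g] by (simp add: pres)
    show "(\<integral>x. g (T x) \<partial>M) = (\<integral>x. g x \<partial>M)"
      using integral_distr[OF T, of g] by (simp add: pres)
  qed
  have int_m: "integrable M (m n)" for n
  proof (induction n)
    case 0 show ?case using integrable_zero[of M] by (simp add: m_def)
  next
    case (Suc n)
    have "integrable M (\<lambda>x. max 0 (f x + m n (T x)))"
      using f int_T(1)[OF Suc] by (intro integrable_max Bochner_Integration.integrable_add) auto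
    moreover have "m (Suc n) = (\<lambda>x. max 0 (f x + m n (T x)))" by (rule ext) (rule mS)
    ultimately show ?case by simp
  qed
  note [measurable] = borel_measurable_integrable[OF int_m]
  have sum_le: "(\<Sum>k<n. f ((T ^^ k) x)) \<le> m n x" for n x
  proof (induction n arbitrary: x)
    case (Suc n)
    have "(\<Sum>k<Suc n. f ((T ^^ k) x)) = f x + (\<Sum>k<n. f ((T ^^ k) (T x)))"
      by (simp add: sum.lessThan_Suc_shift funpow_swap1 del: sum.lessThan_Suc)
    also have "\<dots> \<le> f x + m n (T x)" using Suc by simp
    finally show ?case unfolding mS by simp
  qed (simp add: m0)
  have ex_sum: "\<exists>k\<le>n. m n x = (\<Sum>k<k. f ((T ^^ k) x))" for n x
  proof (induction n arbitrary: x)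
    case (Suc n)
    obtain k where k: "k \<le> n" "m n (T x) = (\<Sum>j<k. f ((T ^^ j) (T x)))" using Suc by blast
    have "f x + m n (T x) = (\<Sum>j<Suc k. f ((T ^^ j) x))"
      by (simp add: k sum.lessThan_Suc_shift funpow_swap1 del: sum.lessThan_Suc)
    then show ?case
      unfolding mS using k by (cases "0 \<le> f x + m n (T x)") (auto intro: exI[of _ "Suc k"] exI[of _ 0])
  qed (simp add: m0)
  have A_iff: "x \<in> A \<longleftrightarrow> (\<exists>n. 0 < m n x)" if "x \<in> space M" for x
    unfolding A_def using that sum_le ex_sum by (auto) (metis less_le_trans, metis)
  define B where "B n = {x \<in> space M. 0 < m n x}" for n
  have [measurable]: "B n \<in> sets M" for n unfolding B_def by measurable
  have AB: "A = (\<Union>n. B n)" unfolding B_def using A_iff by (auto simp: A_def)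
  have [measurable]: "A \<in> sets M" unfolding AB by measurable
  have incB: "incseq B"
    using m_mono by (intro incseq_SucI) (auto simp: B_def intro: less_le_trans)
  have B_int: "0 \<le> (\<integral>x. indicator (B n) x * f x \<partial>M)" for n
  proof (cases n)
    case 0 then show ?thesis by (simp add: B_def m0)
  next
    case (Suc k)
    \<comment> \<open>Invariance of the measure makes this integral vanish. The integrand is at most
      \<open>f\<close> on \<open>B n\<close>, and at most 0 elsewhere because \<open>m n\<close> is
      zero there.\<close>
    have "0 = (\<integral>x. m n x - m n (T x) \<partial>M)"
      using int_m int_T[OF int_m[of n]] by simp
    also have "\<dots> \<le> (\<integral>x. indicator (B n) x * f x \<partial>M)"
    proof (rule integral_mono)
      show "integrable M (\<lambda>x. m n x - m n (T x))" using int_m int_T[OF int_m[of n]] by simp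
      show "integrable M (\<lambda>x. indicator (B n) x * f x)"
        using integrable_mult_indicator[OF _ f, of "B n"] by simp
      fix x assume x: "x \<in> space M"
      show "m n x - m n (T x) \<le> indicator (B n) x * f x"
      proof (cases "x \<in> B n")
        case True
        then have "m n x = f x + m k (T x)" by (auto simp: B_def Suc mS)
        then show ?thesis using True m_mono[of k "T x"] by (simp add: Suc)
      next
        case False
        then have "m n x = 0" using x m_nonneg[of n x] by (auto simp: B_def)
        then show ?thesis using False m_nonneg[of n "T x"] by simp
      qed
    qed
    finally show ?thesis .
  qed
  have "(\<lambda>n. \<integral>x. indicator (B n) x * f x \<partial>M) \<longlonglongrightarrow> (\<integral>x. indicator A x * f x \<partial>M)"
  proof (rule integral_dominated_convergence[where w="\<lambda>x. \<bar>f x\<bar>"])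
    show "AE x in M. (\<lambda>n. indicator (B n) x * f x) \<longlonglongrightarrow> indicator A x * f x"
      unfolding AB by (intro AE_I2 tendsto_mult LIMSEQ_indicator_incseq[OF incB] tendsto_const)
    show "AE x in M. norm (indicator (B n) x * f x) \<le> \<bar>f x\<bar>" for n
      by (intro AE_I2) (auto simp: indicator_def)
  qed (use f in auto)
  then show ?thesis by (rule LIMSEQ_le_const) (use B_int in auto)
qed

text \<open>The upper half of Birkhoff's theorem, with the limit replaced by its bound. On the
  invariant event \<open>E\<close> where the limsup exceeds some \<open>c' > c\<close>, an orbit
  average exceeds \<open>c'\<close> at every point; the maximal inequality then gives
  \<open>c' * measure M E \<le> measure M (E \<inter> B)\<close>, and \<open>bound\<close> forces
  \<open>E\<close> to be null.\<close>

lemma birkhoff_limsup_bound: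
  assumes M: "finite_measure M" and T [measurable]: "T \<in> M \<rightarrow>\<^sub>M M" and pres: "distr M M T = M"
    and B [measurable]: "B \<in> sets M"
    and bound: "\<And>E. E \<in> sets M \<Longrightarrow> T -` E \<inter> space M = E \<Longrightarrow> measure M (E \<inter> B) \<le> c * measure M E"
  shows "AE x in M. limsup (\<lambda>n. ereal (real (card {k \<in> {1..n}. (T ^^ k) x \<in> B}) / real n)) \<le> ereal c"
proof -
  interpret finite_measure M by (rule M)
  have Tsp: "T x \<in> space M" if "x \<in> space M" for x using measurable_space[OF T that] .
  define \<phi> :: "'a \<Rightarrow> real" where "\<phi> = indicator B"
  have [measurable]: "\<phi> \<in> borel_measurable M" by (simp add: \<phi>_def)
  have Tk: "T ^^ k \<in> M \<rightarrow>\<^sub>M M" for k by (rule measurable_compose_n[OF T])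
  \<comment> \<open>The sum starts at \<open>T x\<close> because visits are counted at the times 1
    to n.\<close>
  define a where "a n x = (\<Sum>k<n. \<phi> ((T ^^ Suc k) x)) / real n" for n x
  have \<phi>Tk: "(\<lambda>x. \<phi> ((T ^^ k) x)) \<in> borel_measurable M" for k
    by (rule measurable_compose[OF Tk]) simp
  have [measurable]: "a n \<in> borel_measurable M" for n
    unfolding a_def[abs_def] by (intro borel_measurable_divide borel_measurable_sum \<phi>Tk borel_measurable_const)
  have card_eq: "real (card {k \<in> {1..n}. (T ^^ k) x \<in> B}) / real n = a n x" for n x
  proof -
    have "real (card {k \<in> {1..n}. (T ^^ k) x \<in> B}) = (\<Sum>k\<in>{1..n}. \<phi> ((T ^^ k) x))"
      by (simp add: \<phi>_def indicator_def sum.If_cases Int_def)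
    also have "\<dots> = (\<Sum>k<n. \<phi> ((T ^^ Suc k) x))" unfolding One_nat_def by (rule sum.atLeast1_atMost_eq)
    finally show ?thesis by (simp only: a_def)
  qed
  define F where "F x = limsup (\<lambda>n. ereal (a n x))" for x
  have [measurable]: "F \<in> borel_measurable M" unfolding F_def[abs_def] by measurable
  \<comment> \<open>The averages at \<open>T x\<close> and at \<open>x\<close> differ by two terms
    over \<open>n\<close>. Invariance holds at every point, not just almost everywhere, so
    \<open>E\<close> below meets the exact preimage condition in \<open>bound\<close>.\<close>
  have F_T: "F (T x) = F x" for x
  proof -
    define d where "d n = (\<phi> ((T ^^ Suc n) x) - \<phi> (T x)) / real n" for n
    have "(\<lambda>n. d n) \<longlonglongrightarrow> 0"
    proof (rule Lim_null_comparison)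
      show "\<forall>\<^sub>F n in sequentially. norm (d n) \<le> 1 / real n"
        by (rule always_eventually) (auto simp: d_def \<phi>_def indicator_def)
      show "(\<lambda>n. 1 / real n) \<longlonglongrightarrow> 0" by (rule lim_const_over_n)
    qed
    then have d: "(\<lambda>n. ereal (d n)) \<longlonglongrightarrow> ereal 0" by simp
    have "a n (T x) = d n + a n x" for n
    proof -
      have "(\<Sum>k<n. \<phi> ((T ^^ Suc k) (T x))) + \<phi> (T x) = (\<Sum>k<Suc n. \<phi> ((T ^^ Suc k) x))"
        unfolding sum.lessThan_Suc_shift by (simp add: funpow_swap1)
      then show ?thesis
        unfolding a_def d_def add_divide_distrib[symmetric] sum.lessThan_Suc
        by (intro arg_cong2[of _ _ _ _ "(/)"] refl) linarith
    qed
    then have "F (T x) = limsup (\<lambda>n. ereal (d n) + ereal (a n x))" unfolding F_def by simp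
    also have "\<dots> = ereal 0 + F x" unfolding F_def by (rule ereal_limsup_lim_add[OF d]) simp
    finally show ?thesis by simp
  qed
  have F_Tk: "F ((T ^^ k) x) = F x" for k x by (induction k) (simp_all add: F_T)
  have *: "AE x in M. F x \<le> ereal c'" if c': "c < c'" for c'
  proof -
    define E where "E = {x \<in> space M. ereal c' < F x}"
    have E [measurable]: "E \<in> sets M" unfolding E_def by measurable
    have E_inv: "T -` E \<inter> space M = E" unfolding E_def by (auto simp: F_T Tsp)
    \<comment> \<open>The factor \<open>indicator E\<close> makes \<open>f\<close> vanish off
      \<open>E\<close>, so the integral over the maximal set \<open>A \<supseteq> E\<close> is the
      full integral. On \<open>E\<close> it stays 1 along the whole orbit.\<close>
    define f where "f x = indicator E x * (\<phi> (T x) - c')" for x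
    have int\<phi>: "integrable M (\<lambda>x. indicator E x * \<phi> (T x))"
      by (rule integrable_const_bound[of _ 1]) (auto simp: \<phi>_def indicator_def)
    have f_eq: "f = (\<lambda>x. indicator E x * \<phi> (T x) - c' * indicator E x)"
      by (auto simp: f_def fun_eq_iff algebra_simps)
    have intE: "integrable M (indicator E :: 'a \<Rightarrow> real)"
      by (simp add: integrable_indicator_iff emeasure_eq_measure)
    have f: "integrable M f" unfolding f_eq using int\<phi> intE by simp
    define A where "A = {x \<in> space M. \<exists>n. (\<Sum>k<n. f ((T ^^ k) x)) > 0}"
    have EA: "E \<subseteq> A"
    proof
      fix x assume x: "x \<in> E"
      have "\<exists>\<^sub>F n in sequentially. ereal c' < ereal (a n x)"
      proof (rule ccontr)
        assume "\<not> ?thesis"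
        then have "\<forall>\<^sub>F n in sequentially. ereal (a n x) \<le> ereal c'" by (simp add: frequently_def not_less)
        then have "F x \<le> ereal c'" unfolding F_def by (rule Limsup_bounded)
        then show False using x by (simp add: E_def not_less[symmetric])
      qed
      then have "\<exists>\<^sub>F n in sequentially. ereal c' < ereal (a n x) \<and> 0 < n"
        using eventually_gt_at_top[of "0 :: nat"] by (rule frequently_eventually_frequently)
      then obtain n where n: "c' < a n x" "0 < n" by (auto dest: frequently_ex)
      have "f ((T ^^ k) x) = \<phi> ((T ^^ Suc k) x) - c'" for k
      proof -
        have "(T ^^ k) x \<in> space M" using x by (intro measurable_space[OF Tk]) (auto simp: E_def)
        then have "(T ^^ k) x \<in> E" using x by (simp add: E_def F_Tk)
        then show ?thesis by (simp add: f_def)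
      qed
      then have "(\<Sum>k<n. f ((T ^^ k) x)) = (\<Sum>k<n. \<phi> ((T ^^ Suc k) x)) - n * c'"
        by (simp add: sum_subtractf)
      also have "\<dots> > 0" using n by (simp add: a_def field_simps)
      finally show "x \<in> A" using x by (auto simp: A_def E_def)
    qed
    have "0 \<le> (\<integral>x. indicator A x * f x \<partial>M)"
      unfolding A_def by (rule maximal_ergodic[OF T pres f])
    also have "(\<integral>x. indicator A x * f x \<partial>M) = (\<integral>x. f x \<partial>M)"
      using EA by (intro Bochner_Integration.integral_cong) (auto simp: f_def indicator_def)
    also have "\<dots> = (\<integral>x. indicator E x * \<phi> (T x) \<partial>M) - c' * measure M E"
      unfolding f_eq using int\<phi> intE by simp
    also have "(\<integral>x. indicator E x * \<phi> (T x) \<partial>M) = (\<integral>x. indicator (E \<inter> B) (T x) \<partial>M)"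
    proof (rule Bochner_Integration.integral_cong)
      fix x assume "x \<in> space M"
      then have "x \<in> E \<longleftrightarrow> T x \<in> E" using E_inv by auto
      then show "indicator E x * \<phi> (T x) = indicator (E \<inter> B) (T x)"
        by (simp add: \<phi>_def indicator_inter_arith indicator_def)
    qed simp
    also have "\<dots> = (\<integral>x. indicator (E \<inter> B) x \<partial>distr M M T)"
      by (rule integral_distr[symmetric]) auto
    also have "\<dots> = measure M (E \<inter> B)" using sets.sets_into_space[OF E] by (simp add: pres Int_absorb2 Int_assoc)
    also have "\<dots> \<le> c * measure M E" by (rule bound[OF E E_inv])
    finally have "(c' - c) * measure M E \<le> 0" by (simp add: algebra_simps)
    then have "measure M E = 0" using c' measure_nonneg[of M E] by (auto simp: mult_le_0_iff)
    then have "E \<in> null_sets M" using E by (simp add: null_sets_def emeasure_eq_measure)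
    then show ?thesis by (rule AE_I') (auto simp: E_def)
  qed
  have "AE x in M. \<forall>n. F x \<le> ereal (c + 1 / real (Suc n))"
    unfolding AE_all_countable by (intro allI *) simp
  then show ?thesis
  proof eventually_elim
    case (elim x)
    have "(\<lambda>n. ereal (c + 1 / real (Suc n))) \<longlonglongrightarrow> ereal (c + 0)"
      by (intro tendsto_intros tendsto_ereal LIMSEQ_Suc[OF lim_const_over_n])
    then have "F x \<le> ereal (c + 0)" by (rule LIMSEQ_le_const) (use elim in auto)
    then show ?case by (simp only: F_def card_eq add_0_right)
  qed
qed

section \<open>Trigonometric estimates and rotations of the circle\<close>

lemma jordan_sin:
  fixes x :: real assumes "0 \<le> x" "x \<le> pi / 2" shows "2 / pi * x \<le> sin x"
proof -
  have "concave_on {0..pi/2} sin"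
    by (rule f''_le0_imp_concave[where f'=cos and f''="\<lambda>x. - sin x"])
       (auto intro!: derivative_eq_intros sin_ge_zero)
  from concave_onD[OF this, of "2 / pi * x" 0 "pi/2"] show ?thesis using assms
    by (simp add: field_simps)
qed

text \<open>The left side is twice the distance from \<open>v\<close> to the nearest integer. Since
  \<open>\<bar>sin (pi * v)\<bar>\<close> has period 1, only
  \<open>\<bar>u\<bar> \<le> 1 / 2\<close> matters, which is the range of Jordan's
  inequality.\<close>

lemma sin_pi_ge:
  fixes v :: real
  shows "2 * \<bar>v - of_int (round v)\<bar> \<le> \<bar>sin (pi * v)\<bar>"
proof -
  define u where "u = v - of_int (round v)"
  have u: "\<bar>u\<bar> \<le> 1 / 2" using of_int_round_abs_le[of v] by (simp add: u_def abs_minus_commute)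
  have "\<bar>sin (pi * v)\<bar> = \<bar>sin (pi * u + pi * of_int (round v))\<bar>" by (simp add: u_def algebra_simps)
  also have "\<dots> = \<bar>sin (pi * u)\<bar>"
    unfolding sin_add using sin_zero_iff_int2[of "pi * of_int (round v)"] cos_one_2pi_int
    by (auto simp: abs_mult sin_times_pi_eq_0 cos_squared_eq
          abs_square_eq_1[symmetric] mult.commute)
  also have "\<dots> = sin (pi * \<bar>u\<bar>)"
  proof -
    have "0 \<le> sin (pi * \<bar>u\<bar>)" using u by (intro sin_ge_zero) auto
    then show ?thesis by (cases "u \<ge> 0") auto
  qed
  also have "\<dots> \<ge> 2 / pi * (pi * \<bar>u\<bar>)" using u by (intro jordan_sin) auto
  finally show ?thesis by (simp add: u_def)
qed

lemma sin_small_measure: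
  fixes d e :: real
  assumes "0 \<le> e"
  shows "emeasure lborel {w \<in> {-1..1}. \<bar>sin (pi * (w + d))\<bar> \<le> e} \<le> ennreal (5 * e)"
proof -
  \<comment> \<open>As \<open>w\<close> runs through an interval of length 2, these five integers
    contain every possible nearest integer of \<open>w + d\<close>. Each contributes an interval of
    length \<open>e\<close>, hence the factor 5.\<close>
  define K where "K = {\<lfloor>d\<rfloor> - 1 .. \<lfloor>d\<rfloor> + 3}"
  have "{w \<in> {-1..1}. \<bar>sin (pi * (w + d))\<bar> \<le> e} \<subseteq> (\<Union>k\<in>K. {of_int k - d - e/2 .. of_int k - d + e/2})"
  proof safe
    fix w :: real assume w: "w \<in> {-1..1}" "\<bar>sin (pi * (w + d))\<bar> \<le> e"
    define k where "k = round (w + d)"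
    have "2 * \<bar>w + d - of_int k\<bar> \<le> e" using sin_pi_ge[of "w + d"] w by (simp add: k_def)
    moreover have "k \<in> K" using w unfolding k_def K_def round_def by simp linarith
    moreover from calculation have "w \<in> {of_int k - d - e/2 .. of_int k - d + e/2}"
      using abs_ge_self[of "w + d - of_int k"] abs_ge_minus_self[of "w + d - of_int k"] by simp
    ultimately show "w \<in> (\<Union>k\<in>K. {of_int k - d - e/2 .. of_int k - d + e/2})" by blast
  qed
  then have "emeasure lborel {w \<in> {-1..1}. \<bar>sin (pi * (w + d))\<bar> \<le> e} \<le>
     emeasure lborel (\<Union>k\<in>K. {of_int k - d - e/2 .. of_int k - d + e/2})"
    by (intro emeasure_mono) (auto simp: K_def)
  also have "\<dots> \<le> (\<Sum>k\<in>K. emeasure lborel {of_int k - d - e/2 .. of_int k - d + e/2})"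
    by (intro emeasure_subadditive_finite) (auto simp: K_def)
  also have "\<dots> = (\<Sum>k\<in>K. ennreal e)" using assms by (intro sum.cong) (auto)
  also have "\<dots> = ennreal (5 * e)" using assms by (simp add: K_def ennreal_mult)
  finally show ?thesis .
qed

text \<open>Two points w, w' of the set satisfy
  \<open>\<bar>sin (pi (w - w'))\<bar> \<le> sqrt h\<close> or \<open>\<bar>cos (pi (2 c + w + w'))\<bar> \<le> sqrt h\<close>, by the sum-to-product formula.\<close>
lemma sin_band_measure:
  fixes b c h :: real
  assumes h: "0 \<le> h"
  shows "emeasure lborel {w \<in> {-1..1}. \<bar>sin (2 * pi * (w + c)) - b\<bar> \<le> h} \<le> ennreal (10 * sqrt h)"
    (is "emeasure lborel ?S \<le> _")
proof (cases "?S = {}")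
  case False
  \<comment> \<open>A point of the set replaces an arcsine of \<open>b\<close>, which need not
    exist: any two sines in the band differ by at most \<open>2 * h\<close>.\<close>
  then obtain w' where w': "w' \<in> ?S" by blast
  define A where "A d = {w \<in> {-1..1}. \<bar>sin (pi * (w + d))\<bar> \<le> sqrt h}" for d :: real
  have [measurable]: "A d \<in> sets borel" for d unfolding A_def by measurable
  have "?S \<subseteq> A (- w') \<union> A (2 * c + w' + 1/2)"
  proof
    fix w assume w: "w \<in> ?S"
    have "sin (2 * pi * (w + c)) - sin (2 * pi * (w' + c)) =
        2 * sin (pi * (w - w')) * cos (pi * (w + w' + 2 * c))"
    proof -
      have "(2 * pi * (w + c) - 2 * pi * (w' + c)) / 2 = pi * (w - w')"
           "(2 * pi * (w + c) + 2 * pi * (w' + c)) / 2 = pi * (w + w' + 2 * c)"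
        by (simp_all add: field_simps)
      then show ?thesis by (simp only: sin_diff_sin)
    qed
    also have "cos (pi * (w + w' + 2 * c)) = sin (pi * (w + (2 * c + w' + 1/2)))"
    proof -
      have "pi * (w + (2 * c + w' + 1/2)) = pi * (w + w' + 2 * c) + pi / 2" by (simp add: algebra_simps)
      then show ?thesis by (simp only: sin_add) simp
    qed
    finally have "2 * (\<bar>sin (pi * (w - w'))\<bar> * \<bar>sin (pi * (w + (2 * c + w' + 1/2)))\<bar>) \<le> 2 * h"
      using w w' by (auto simp: abs_mult[symmetric])
    then have "\<bar>sin (pi * (w - w'))\<bar> * \<bar>sin (pi * (w + (2 * c + w' + 1/2)))\<bar> \<le> sqrt h * sqrt h"
      using h by simp
    then have "\<bar>sin (pi * (w - w'))\<bar> \<le> sqrt h \<or> \<bar>sin (pi * (w + (2 * c + w' + 1/2)))\<bar> \<le> sqrt h"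
      using h by (meson mult_strict_mono' not_le real_sqrt_ge_zero)
    then show "w \<in> A (- w') \<union> A (2 * c + w' + 1/2)" using w by (auto simp: A_def)
  qed
  then have "emeasure lborel ?S \<le> emeasure lborel (A (- w') \<union> A (2 * c + w' + 1/2))"
    by (intro emeasure_mono) auto
  also have "\<dots> \<le> emeasure lborel (A (- w')) + emeasure lborel (A (2 * c + w' + 1/2))"
    by (intro emeasure_subadditive) auto
  also have "\<dots> \<le> ennreal (5 * sqrt h) + ennreal (5 * sqrt h)"
    unfolding A_def using h by (intro add_mono sin_small_measure) auto
  also have "\<dots> = ennreal (10 * sqrt h)" using h by (simp add: ennreal_plus[symmetric] del: ennreal_plus)
  finally show ?thesis .
qed (metis emeasure_empty zero_le)

section \<open>Lebesgue measure on the circle and its isometries\<close>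

lemma lborel_emeasure_translate:
  fixes B :: "real set" assumes "B \<in> sets borel"
  shows "emeasure lborel ((\<lambda>x. x + a) -` B) = emeasure lborel B"
proof -
  have "emeasure lborel B = emeasure (distr lborel borel ((+) a)) B"
    by (simp add: lborel_distr_plus)
  also have "\<dots> = emeasure lborel ((+) a -` B \<inter> space lborel)"
    by (rule emeasure_distr) (use assms in auto)
  finally show ?thesis by (simp add: add.commute vimage_def)
qed

definition circle :: "real measure" where "circle = restrict_space lborel {0..<1}"

lemma sets_circle: "sets circle = sets (restrict_space borel {0..<1})"
  unfolding circle_def by (rule sets_restrict_space_cong) simp

lemma space_circle [simp]: "space circle = {0..<1}" by (simp add: circle_def space_restrict_space)

lemma measurable_circle_iff: "g \<in> M \<rightarrow>\<^sub>M circle \<longleftrightarrow> g \<in> borel_measurable M \<and> g \<in> space M \<rightarrow> {0..<1}"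
  unfolding measurable_cong_sets[OF refl sets_circle] by (auto simp: measurable_restrict_space2_iff)

lemma borel_measurable_frac [measurable]: "(frac :: real \<Rightarrow> real) \<in> borel_measurable borel"
  unfolding frac_def[abs_def] by measurable

lemma measurable_frac_circle [measurable (raw)]: "g \<in> borel_measurable M \<Longrightarrow> (\<lambda>x. frac (g x)) \<in> M \<rightarrow>\<^sub>M circle"
  by (auto simp: measurable_circle_iff frac_lt_1)

lemma measurable_circle_borel [measurable (raw)]: "g \<in> M \<rightarrow>\<^sub>M circle \<Longrightarrow> g \<in> borel_measurable M"
  by (simp add: measurable_circle_iff)

lemma sets_circleD: "B \<in> sets circle \<Longrightarrow> B \<in> sets borel \<and> B \<subseteq> {0..<1}"
  using sets.sets_into_space[of B circle] sets_circle by (simp add: sets_restrict_space_iff)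

lemma emeasure_circle: "B \<in> sets circle \<Longrightarrow> emeasure circle B = emeasure lborel B"
  using sets_circleD[of B] unfolding circle_def by (intro emeasure_restrict_space) auto

text \<open>With \<open>t = frac a\<close>, the rotation is translation by \<open>t\<close> on one
  subinterval and by \<open>t - 1\<close> on the other. The images fill \<open>{t..<1}\<close> and
  \<open>{0..<t}\<close>, and Lebesgue measure is translation invariant on each piece.\<close>

lemma distr_circle_rotate: "distr circle circle (\<lambda>x. frac (x + a)) = circle"
proof (rule measure_eqI)
  fix B assume "B \<in> sets (distr circle circle (\<lambda>x. frac (x + a)))"
  then have B: "B \<in> sets circle" by simp
  then have B' [measurable]: "B \<in> sets borel" and B01: "B \<subseteq> {0..<1}" using sets_circleD by auto
  define t where "t = frac a"
  have t: "0 \<le> t" "t < 1" by (auto simp: t_def frac_lt_1)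
  have fr: "frac (x + a) = (if x < 1 - t then x + t else x + (t - 1))" if "x \<in> {0..<1}" for x
  proof -
    have "frac x = x" using that by (simp add: frac_eq)
    then show ?thesis by (simp add: frac_add t_def)
  qed
  have "emeasure (distr circle circle (\<lambda>x. frac (x + a))) B
      = emeasure circle ((\<lambda>x. frac (x + a)) -` B \<inter> space circle)"
    by (rule emeasure_distr) (use B in measurable)
  also have "\<dots> = emeasure lborel ((\<lambda>x. frac (x + a)) -` B \<inter> space circle)"
    by (intro emeasure_circle measurable_sets[OF _ B]) measurable
  also have "(\<lambda>x. frac (x + a)) -` B \<inter> space circle = 
     (\<lambda>x. x + t) -` (B \<inter> {t..<1}) \<union> (\<lambda>x. x + (t - 1)) -` (B \<inter> {0..<t})"
    using B01 t by (auto simp: fr split: if_splits)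
  also have "emeasure lborel \<dots> = emeasure lborel ((\<lambda>x. x + t) -` (B \<inter> {t..<1})) + emeasure lborel ((\<lambda>x. x + (t - 1)) -` (B \<inter> {0..<t}))"
    by (rule plus_emeasure[symmetric]) auto
  also have "\<dots> = emeasure lborel (B \<inter> {t..<1}) + emeasure lborel (B \<inter> {0..<t})"
    by (intro arg_cong2[of _ _ _ _ "(+)"] lborel_emeasure_translate) measurable
  also have "\<dots> = emeasure lborel ((B \<inter> {t..<1}) \<union> (B \<inter> {0..<t}))"
    by (rule plus_emeasure) auto
  also have "(B \<inter> {t..<1}) \<union> (B \<inter> {0..<t}) = B" using B01 t by auto
  finally show "emeasure (distr circle circle (\<lambda>x. frac (x + a))) B = emeasure circle B"
    by (simp add: emeasure_circle B)
qed simp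

text \<open>Away from the end points \<open>frac (- x)\<close> is \<open>1 - x\<close>, which
  preserves Lebesgue measure; a rotation by \<open>a\<close> then gives the general case.\<close>

lemma distr_circle_reflect: "distr circle circle (\<lambda>x. frac (a - x)) = circle"
proof -
  have "distr circle circle (\<lambda>x. frac (- x)) = circle"
  proof (rule measure_eqI)
    fix B assume "B \<in> sets (distr circle circle (\<lambda>x. frac (- x)))"
    then have B: "B \<in> sets circle" by simp
    then have B' [measurable]: "B \<in> sets borel" and B01: "B \<subseteq> {0..<1}" using sets_circleD by auto
    have "emeasure (distr circle circle (\<lambda>x. frac (- x))) B
        = emeasure circle ((\<lambda>x. frac (- x)) -` B \<inter> space circle)"
      by (rule emeasure_distr) (use B in measurable)
    also have "\<dots> = emeasure lborel ((\<lambda>x. frac (- x)) -` B \<inter> space circle)"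
      by (intro emeasure_circle measurable_sets[OF _ B]) measurable
    also have "\<dots> = emeasure lborel (uminus -` ((\<lambda>x. x + 1) -` B))"
    proof (rule emeasure_eq_AE)
      have "AE x in lborel. x \<noteq> 0" "AE x in lborel. x \<noteq> (1::real)" by (rule AE_lborel_singleton)+
      then show "AE x in lborel. (x \<in> (\<lambda>x. frac (- x)) -` B \<inter> space circle) \<longleftrightarrow> x \<in> uminus -` ((\<lambda>x. x + 1) -` B)"
      proof eventually_elim
        case (elim x)
        have "frac (- x) = 1 - x" if "0 < x" "x < 1" using that by (simp add: frac_unique_iff)
        then show ?case using elim B01 by (auto) 
      qed
      show "(\<lambda>x. frac (- x)) -` B \<inter> space circle \<in> sets lborel" by simp
      show "uminus -` ((\<lambda>x. x + 1) -` B) \<in> sets lborel"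
        using measurable_sets[of "\<lambda>x. - x + 1" borel borel B] by (simp add: vimage_def)
    qed
    also have "\<dots> = emeasure (distr lborel borel uminus) ((\<lambda>x. x + 1) -` B)"
      using measurable_sets[of "\<lambda>x. x + 1" borel borel B] by (subst emeasure_distr) auto
    also have "\<dots> = emeasure lborel B"
      by (simp add: lborel_distr_uminus lborel_emeasure_translate)
    finally show "emeasure (distr circle circle (\<lambda>x. frac (- x))) B = emeasure circle B"
      by (simp add: emeasure_circle B)
  qed simp
  then have "distr circle circle (\<lambda>x. frac (a - x)) = distr (distr circle circle (\<lambda>x. frac (- x))) circle (\<lambda>x. frac (x + a))"
    by (subst distr_distr) (auto simp: comp_def add.commute)
  also have "\<dots> = circle" by (simp add: \<open>distr circle circle (\<lambda>x. frac (- x)) = circle\<close> distr_circle_rotate)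
  finally show ?thesis .
qed

section \<open>Cocycle and stable directions\<close>

lemma deriv_std_f: "deriv (std_f L) x = - 2 * pi * L * sin (2 * pi * x)"
proof -
  have "(std_f L has_field_derivative - 2 * pi * L * sin (2 * pi * x)) (at x)"
    unfolding std_f_def by (auto intro!: derivative_eq_intros)
  then show ?thesis by (rule DERIV_imp_deriv)
qed

lemma cos_add_int: "cos (2 * pi * (x + of_int k)) = cos (2 * pi * x)"
  using sin_cos_eq_iff[of "2 * pi * (x + of_int k)" "2 * pi * x"]
  by (metis add.commute distrib_left mult.assoc mult.commute)

lemma sin_add_int: "sin (2 * pi * (x + of_int k)) = sin (2 * pi * x)"
  using sin_cos_eq_iff[of "2 * pi * (x + of_int k)" "2 * pi * x"]
  by (metis add.commute distrib_left mult.assoc mult.commute)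

lemma sin_2pi_frac: "sin (2 * pi * frac x) = sin (2 * pi * x)"
  using sin_add_int[of x "- \<lfloor>x\<rfloor>"] by (simp add: frac_def)

lemma frac_diff_frac: "frac (a - frac b) = frac (a - b)" for a b :: real
  using frac_add_of_int_right[of "a - b" "\<lfloor>b\<rfloor>"] by (simp add: frac_def[of b] algebra_simps)

lemma has_derivative_std_lift:
  "(std_lift L w has_derivative (\<lambda>(h, k). (deriv (std_f L) (x + w) * h - k, h))) (at (x, y))"
  unfolding std_lift_def case_prod_unfold deriv_std_f std_f_def
  by (auto intro!: derivative_eq_intros simp: fun_eq_iff)

lemma frechet_std_lift:
  "frechet_derivative (std_lift L w) (at (x, y)) = (\<lambda>(h, k). (deriv (std_f L) (x + w) * h - k, h))"
  using frechet_derivative_at[OF has_derivative_std_lift] by simp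

lemma frechet_inv_lift:
  "frechet_derivative (inv_lift L w) (at (x, y)) = (\<lambda>(h, k). (k, deriv (std_f L) y * k - h))"
  using frechet_derivative_at[OF has_derivative_inv_lift] by simp

lemma std_lift_differentiable: "std_lift L w differentiable (at z)"
  using has_derivative_std_lift[of L w "fst z" "snd z"] by (auto simp: differentiable_def)

lemma lift_iter_differentiable: "lift_iter L \<omega> n differentiable (at z)"
proof (induction n)
  case (Suc n)
  then show ?case
    unfolding lift_iter.simps by (rule differentiable_chain_at) (rule std_lift_differentiable)
qed simp

lemma lift_iter_Suc_shift:
  "lift_iter L \<omega> (Suc n) = lift_iter L (\<lambda>n. \<omega> (Suc n)) n \<circ> std_lift L (\<omega> 0)"
proof (induction n)
  case (Suc n)
  then show ?case by (simp only: lift_iter.simps(2) comp_assoc)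
qed simp

text \<open>The integers on the right do not depend on \<open>z\<close>. This makes the derivative
  of a lift a function on the torus, although the lift itself is not.\<close>

lemma lift_iter_add_int:
  "\<exists>a' b' :: int. \<forall>z. lift_iter L \<omega> n (z + (of_int a, of_int b)) = lift_iter L \<omega> n z + (of_int a', of_int b')"
proof (induction n)
  case (Suc n)
  then obtain a' b' :: int where
    ab: "\<And>z. lift_iter L \<omega> n (z + (of_int a, of_int b)) = lift_iter L \<omega> n z + (of_int a', of_int b')" by blast
  have "std_lift L w (z + (of_int a', of_int b')) = std_lift L w z + (of_int (- b'), of_int a')" for w z
    using cos_add_int[of "fst z + w" a'] by (cases z) (simp add: std_lift_def std_f_def algebra_simps)
  then show ?case by (intro exI[of _ "- b'"] exI[of _ a']) (simp add: ab)
qed (auto intro: exI[of _ a] exI[of _ b])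

lemma frechet_lift_iter_add_int:
  "frechet_derivative (lift_iter L \<omega> n) (at (z + (of_int a, of_int b))) = frechet_derivative (lift_iter L \<omega> n) (at z)"
proof -
  let ?k = "(of_int a, of_int b) :: real \<times> real"
  obtain c where c: "\<And>z. lift_iter L \<omega> n (z + ?k) = lift_iter L \<omega> n z + c"
    using lift_iter_add_int by metis
  have "(lift_iter L \<omega> n has_derivative frechet_derivative (lift_iter L \<omega> n) (at (z + ?k))) (at (z + ?k))"
    using lift_iter_differentiable by (simp add: frechet_derivative_works)
  then have "((\<lambda>z. lift_iter L \<omega> n (z + ?k)) has_derivative frechet_derivative (lift_iter L \<omega> n) (at (z + ?k))) (at z)"
    by (rule has_derivative_compose[rotated, where f="\<lambda>z. z + ?k", simplified])
       (auto intro!: derivative_eq_intros)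
  then have "((\<lambda>z. lift_iter L \<omega> n z + c - c) has_derivative frechet_derivative (lift_iter L \<omega> n) (at (z + ?k))) (at z)"
    unfolding c by (intro has_derivative_diff[where g'="\<lambda>_. 0", simplified] has_derivative_const) 
  then have "(lift_iter L \<omega> n has_derivative frechet_derivative (lift_iter L \<omega> n) (at (z + ?k))) (at z)"
    by simp
  from frechet_derivative_at[OF this] show ?thesis by simp
qed

lemma mod1_eq: "mod1 z = z + (of_int (- \<lfloor>fst z\<rfloor>), of_int (- \<lfloor>snd z\<rfloor>))"
  by (cases z) (simp add: mod1_def, simp add: frac_def)

text \<open>The definition of \<open>lift_iter\<close> adds the newest map on the outside, whereas
  comparing a point with its skew image requires splitting off the first one. The remaining lift
  starts at the unreduced image; periodicity of its derivative allows passing to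
  \<open>std_map\<close>.\<close>

lemma cocycle_Suc:
  "cocycle L \<omega> (Suc n) z v =
   cocycle L (\<lambda>n. \<omega> (Suc n)) n (std_map L (\<omega> 0) z) (frechet_derivative (std_lift L (\<omega> 0)) (at z) v)"
proof -
  have "(lift_iter L (\<lambda>n. \<omega> (Suc n)) n \<circ> std_lift L (\<omega> 0) has_derivative
      frechet_derivative (lift_iter L (\<lambda>n. \<omega> (Suc n)) n) (at (std_lift L (\<omega> 0) z)) \<circ>
      frechet_derivative (std_lift L (\<omega> 0)) (at z)) (at z)"
    using lift_iter_differentiable std_lift_differentiable
    by (intro diff_chain_at) (simp_all add: frechet_derivative_works)
  from frechet_derivative_at[OF this] show ?thesis
    unfolding cocycle_def lift_iter_Suc_shift std_map_def mod1_eq[of "std_lift L (\<omega> 0) z"]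
      frechet_lift_iter_add_int by (metis comp_apply)
qed

lemma bounded_linear_cocycle: "bounded_linear (cocycle L \<omega> n z)"
  unfolding cocycle_def
  using lift_iter_differentiable[unfolded frechet_derivative_works] by (rule has_derivative_bounded_linear)

section \<open>Angles of vectors and uniqueness of the stable direction\<close>

text \<open>Turns the definite description in \<open>direction\<close> into an arctangent formula,
  from which measurability can be read off. Negative arctangents are raised by \<open>pi\<close> to
  land in \<open>proj_line\<close>.\<close>

lemma direction_polar:
  assumes "(a, b) \<noteq> (0, 0)"
  defines "t \<equiv> (if a = 0 then pi / 2 else if b / a \<ge> 0 then arctan (b / a) else arctan (b / a) + pi)"
  shows "direction (a, b) = t" "t \<in> proj_line" "\<exists>c. (a, b) = c *\<^sub>R unit_vec t"
proof -
  show t: "t \<in> proj_line"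
    using arctan_bounded[of "b / a"] pi_gt_zero by (auto simp: t_def proj_line_def)
  have "\<exists>c. (a, b) = c *\<^sub>R unit_vec t"
  proof (cases "a = 0")
    case True
    then show ?thesis by (intro exI[of _ b]) (simp add: t_def unit_vec_def)
  next
    case False
    have "tan t = b / a" by (simp add: t_def tan_arctan False)
    moreover have c: "cos t \<noteq> 0" using False by (auto simp: t_def)
    ultimately have "sin t = b / a * cos t" by (simp add: tan_def field_simps)
    then show ?thesis using c False by (intro exI[of _ "a / cos t"]) (simp add: unit_vec_def)
  qed
  then show "\<exists>c. (a, b) = c *\<^sub>R unit_vec t" .
  then show "direction (a, b) = t"
    using direction_unique[OF t] assms(1) by (metis zero_prod_def)
qed

lemma direction_cases:
  assumes "v \<noteq> 0" obtains c where "c \<noteq> 0" "direction v \<in> proj_line" "v = c *\<^sub>R unit_vec (direction v)"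
proof (cases v)
  case (Pair a b)
  then have "(a, b) \<noteq> (0, 0)" using assms by (simp add: zero_prod_def)
  then obtain c t where t: "direction v = t" "t \<in> proj_line" and c: "v = c *\<^sub>R unit_vec t"
    using direction_polar[of a b] unfolding Pair by blast
  have "c \<noteq> 0" using assms unfolding c by auto
  then show thesis
  proof (rule that)
    show "direction v \<in> proj_line" unfolding t(1) by (rule t(2))
    show "v = c *\<^sub>R unit_vec (direction v)" unfolding t(1) by (rule c)
  qed
qed

lemma inv_proj_step_eq:
  "inv_proj_step L w ((x, y), \<theta>) =
     ((frac (y - w), frac (std_f L y - x)), direction (sin \<theta>, deriv (std_f L) y * sin \<theta> - cos \<theta>))"
  unfolding inv_proj_step_def case_prod_conv frechet_inv_lift unit_vec_def mod1_def
  by (simp add: inv_lift_def)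

lemma sin_cos_not_both_0: "(sin \<theta>, d * sin \<theta> - cos \<theta>) \<noteq> (0, 0 :: real)"
  using sin_zero_abs_cos_one[of \<theta>] by (cases "sin \<theta> = 0") simp_all

lemma inv_proj_step_std_map:
  assumes "z \<in> torus"
  shows "fst (inv_proj_step L w (std_map L w z, \<theta>)) = z"
proof -
  obtain x y where z: "z = (x, y)" by (cases z)
  have xy: "0 \<le> x" "x < 1" "0 \<le> y" "y < 1" using assms by (auto simp: z torus_def)
  have fr: "frac (frac a - b) = frac (a - b)" for a b :: real
    using frac_add_simps(1)[of a "- b"] by simp
  have "std_f L (frac (x + w)) = std_f L (x + w)"
    using cos_add_int[of "x + w" "- \<lfloor>x + w\<rfloor>"] by (simp add: std_f_def frac_def)
  then have "frac (std_f L (frac (x + w)) - frac (std_f L (x + w) - y)) = frac y"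
    by (simp add: frac_diff_frac)
  then show ?thesis
    using xy by (simp add: z std_map_def std_lift_def mod1_def inv_proj_step_eq fr frac_eq)
qed

text \<open>Two distinct directions form a basis, so bounded images of both bound the operator norm
  and its exponent cannot be positive. Asking for boundedness instead of a decay rate avoids
  comparing the exponents at a point and at its image.\<close>

lemma stable_unique:
  assumes lim: "(\<lambda>n. ln (onorm (cocycle L \<omega> n z)) / real n) \<longlonglongrightarrow> l" and l: "l > 0"
    and 1: "\<forall>\<^sub>F n in sequentially. norm (cocycle L \<omega> n z (unit_vec \<theta>)) \<le> C"
    and 2: "\<forall>\<^sub>F n in sequentially. norm (cocycle L \<omega> n z (unit_vec \<theta>')) \<le> C'"
    and \<theta>: "\<theta> \<in> proj_line" "\<theta>' \<in> proj_line"
  shows "\<theta> = \<theta>'"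
proof (rule ccontr)
  assume ne: "\<theta> \<noteq> \<theta>'"
  define D where "D = sin (\<theta>' - \<theta>)"
  have "\<bar>\<theta>' - \<theta>\<bar> < pi" using \<theta> by (auto simp: proj_line_def)
  then have D: "D \<noteq> 0" using ne sin_eq_0_pi[of "\<theta>' - \<theta>"] unfolding D_def by force
  \<comment> \<open>The coordinates of \<open>v\<close> in the basis are at most
    \<open>2 * norm v / \<bar>D\<bar>\<close>. The maximum with 1 keeps \<open>ln K\<close>
    nonnegative, which covers a zero operator norm, where \<open>ln 0 = 0\<close>.\<close>
  define K where "K = max 1 (2 / \<bar>D\<bar> * C + 2 / \<bar>D\<bar> * C')"
  have "\<forall>\<^sub>F n in sequentially. ln (onorm (cocycle L \<omega> n z)) / real n \<le> ln K / real n"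
    using 1 2
  proof eventually_elim
    case (elim n)
    let ?A = "cocycle L \<omega> n z"
    interpret bounded_linear ?A by (rule bounded_linear_cocycle)
    have "norm (?A v) \<le> K * norm v" for v
    proof -
      obtain a b where v: "v = (a, b)" by (cases v)
      \<comment> \<open>Cramer's rule; \<open>D\<close> is the determinant of the two unit
        vectors.\<close>
      define p q where "p = (a * sin \<theta>' - b * cos \<theta>') / D" and "q = (b * cos \<theta> - a * sin \<theta>) / D"
      have "p * cos \<theta> + q * cos \<theta>' = a * D / D" "p * sin \<theta> + q * sin \<theta>' = b * D / D"
        unfolding p_def q_def D_def sin_diff by (simp_all add: add_divide_distrib[symmetric] algebra_simps)
      then have "v = p *\<^sub>R unit_vec \<theta> + q *\<^sub>R unit_vec \<theta>'"
        using D by (simp add: v unit_vec_def)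
      then have "norm (?A v) = norm (p *\<^sub>R ?A (unit_vec \<theta>) + q *\<^sub>R ?A (unit_vec \<theta>'))"
        by (simp add: add scaleR)
      also have "\<dots> \<le> \<bar>p\<bar> * norm (?A (unit_vec \<theta>)) + \<bar>q\<bar> * norm (?A (unit_vec \<theta>'))"
        by (rule order_trans[OF norm_triangle_ineq]) simp
      also have "\<dots> \<le> \<bar>p\<bar> * C + \<bar>q\<bar> * C'" using elim by (intro add_mono mult_left_mono) auto
      also have "\<dots> \<le> (2 * norm v / \<bar>D\<bar>) * C + (2 * norm v / \<bar>D\<bar>) * C'"
      proof -
        have n: "\<bar>a\<bar> \<le> norm v" "\<bar>b\<bar> \<le> norm v"
          using norm_fst_le[of a b] norm_snd_le[of b a] by (simp_all add: v)
        have *: "\<bar>a * s + b * t\<bar> \<le> 2 * norm v" if "\<bar>s\<bar> \<le> 1" "\<bar>t\<bar> \<le> 1" for s t :: real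
        proof -
          have "\<bar>a * s\<bar> \<le> norm v * 1" "\<bar>b * t\<bar> \<le> norm v * 1"
            unfolding abs_mult using n that by (intro mult_mono; auto)+
          then show ?thesis by linarith
        qed
        have "\<bar>p\<bar> \<le> 2 * norm v / \<bar>D\<bar>" "\<bar>q\<bar> \<le> 2 * norm v / \<bar>D\<bar>"
          using *[of "sin \<theta>'" "- cos \<theta>'"] *[of "- sin \<theta>" "cos \<theta>"]
          by (simp_all add: p_def q_def divide_right_mono)
        moreover have "0 \<le> C" "0 \<le> C'" using elim norm_ge_zero order_trans by blast+
        ultimately show ?thesis by (intro add_mono mult_right_mono) auto
      qed
      also have "\<dots> = (2 / \<bar>D\<bar> * C + 2 / \<bar>D\<bar> * C') * norm v" by (simp add: algebra_simps)
      also have "\<dots> \<le> K * norm v" by (intro mult_right_mono) (auto simp: K_def)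
      finally show ?thesis .
    qed
    then have "onorm ?A \<le> K" by (intro onorm_bound) (auto simp: K_def)
    moreover have "0 \<le> onorm ?A" by (rule onorm_pos_le) (rule bounded_linear_cocycle)
    moreover have "1 \<le> K" by (simp add: K_def)
    ultimately have "ln (onorm ?A) \<le> ln K" by (cases "onorm ?A = 0") auto
    then show ?case by (intro divide_right_mono) auto
  qed
  moreover have "(\<lambda>n. ln K / real n) \<longlonglongrightarrow> 0" by (rule lim_const_over_n)
  ultimately have "l \<le> 0" by (intro tendsto_le[OF trivial_limit_sequentially _ lim])
  then show False using l by simp
qed

lemma stable_at_eventually_bounded:
  assumes "stable_at L \<omega> z \<theta>"
  shows "\<forall>\<^sub>F n in sequentially. norm (cocycle L \<omega> n z (unit_vec \<theta>)) \<le> 1"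
proof -
  obtain l where "l > 0" "(\<lambda>n. ln (norm (cocycle L \<omega> n z (unit_vec \<theta>))) / real n) \<longlonglongrightarrow> - l"
    using assms by (auto simp: stable_at_def)
  then have "\<forall>\<^sub>F n in sequentially. ln (norm (cocycle L \<omega> n z (unit_vec \<theta>))) / real n < 0"
    by (intro order_tendstoD(2)[of _ "- l"]) auto
  then show ?thesis
  proof eventually_elim
    case (elim n)
    then have "ln (norm (cocycle L \<omega> n z (unit_vec \<theta>))) < 0"
      by (auto simp: divide_less_0_iff)
    then show ?case using ln_ge_zero[of "norm (cocycle L \<omega> n z (unit_vec \<theta>))"] by linarith
  qed
qed

text \<open>Let \<open>v\<close> be the preimage of \<open>unit_vec \<theta>1\<close> under the
  derivative of the first map. Later images of \<open>v\<close> are those of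
  \<open>unit_vec \<theta>1\<close> along the shifted noise, hence bounded, and
  \<open>stable_unique\<close> identifies the direction of \<open>v\<close> with
  \<open>\<theta>\<close>.\<close>

lemma stable_at_pullback:
  assumes z: "z \<in> torus" and s: "stable_at L \<omega> z \<theta>"
    and s1: "stable_at L (\<lambda>n. \<omega> (Suc n)) (std_map L (\<omega> 0) z) \<theta>1"
  shows "inv_proj_step L (\<omega> 0) (std_map L (\<omega> 0) z, \<theta>1) = (z, \<theta>)"
proof (rule prod_eqI)
  show "fst (inv_proj_step L (\<omega> 0) (std_map L (\<omega> 0) z, \<theta>1)) = fst (z, \<theta>)"
    using inv_proj_step_std_map[OF z] by simp
  obtain x y where xy: "z = (x, y)" by (cases z)
  define d where "d = deriv (std_f L) (x + \<omega> 0)"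
  define v where "v = (sin \<theta>1, d * sin \<theta>1 - cos \<theta>1)"
  have "v \<noteq> 0" using sin_cos_not_both_0 by (simp add: v_def zero_prod_def)
  then obtain c where c: "c \<noteq> 0" "direction v \<in> proj_line" "v = c *\<^sub>R unit_vec (direction v)"
    by (rule direction_cases)
  have "deriv (std_f L) (frac (x + \<omega> 0)) = d" by (simp add: d_def deriv_std_f sin_2pi_frac)
  then have step: "snd (inv_proj_step L (\<omega> 0) (std_map L (\<omega> 0) z, \<theta>1)) = direction v"
    by (simp add: xy std_map_def std_lift_def mod1_def inv_proj_step_eq v_def)
  have D: "frechet_derivative (std_lift L (\<omega> 0)) (at z) v = unit_vec \<theta>1"
    by (simp add: xy frechet_std_lift v_def unit_vec_def d_def)
  have coc: "\<bar>c\<bar> * norm (cocycle L \<omega> (Suc n) z (unit_vec (direction v))) =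
      norm (cocycle L (\<lambda>n. \<omega> (Suc n)) n (std_map L (\<omega> 0) z) (unit_vec \<theta>1))" for n
  proof -
    have "cocycle L \<omega> (Suc n) z v = c *\<^sub>R cocycle L \<omega> (Suc n) z (unit_vec (direction v))"
      by (subst c(3)) (rule linear_scale[OF bounded_linear.linear[OF bounded_linear_cocycle]])
    then have "c *\<^sub>R cocycle L \<omega> (Suc n) z (unit_vec (direction v)) =
        cocycle L (\<lambda>n. \<omega> (Suc n)) n (std_map L (\<omega> 0) z) (unit_vec \<theta>1)"
      using cocycle_Suc[of L \<omega> n z v] unfolding D by (rule subst)
    then show ?thesis by (metis norm_scaleR)
  qed
  have "\<forall>\<^sub>F n in sequentially. norm (cocycle L \<omega> (Suc n) z (unit_vec (direction v))) \<le> 1 / \<bar>c\<bar>"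
    using stable_at_eventually_bounded[OF s1]
    by eventually_elim (use c coc in \<open>simp add: field_simps\<close>)
  then have "\<forall>\<^sub>F n in sequentially. norm (cocycle L \<omega> n z (unit_vec (direction v))) \<le> 1 / \<bar>c\<bar>"
    by (rule eventually_sequentially_Suc[THEN iffD1])
  moreover obtain l where "(\<lambda>n. ln (onorm (cocycle L \<omega> n z)) / real n) \<longlonglongrightarrow> l" "l > 0" "\<theta> \<in> proj_line"
    using s by (auto simp: stable_at_def)
  ultimately have "\<theta> = direction v"
    using stable_at_eventually_bounded[OF s] c(2) by (intro stable_unique) auto
  then show "snd (inv_proj_step L (\<omega> 0) (std_map L (\<omega> 0) z, \<theta>1)) = snd (z, \<theta>)"
    by (simp add: step)
qed

lemma ang_dist_vertical: "\<theta> \<in> proj_line \<Longrightarrow> ang_dist \<theta> (pi / 2) = \<bar>\<theta> - pi / 2\<bar>"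
  by (auto simp: ang_dist_def proj_line_def min_def abs_if)

text \<open>Uses \<open>\<bar>cos t\<bar> \<ge> 2 / pi * \<bar>t - pi / 2\<bar>\<close>.\<close>
lemma direction_far_from_vertical:
  assumes "ang_dist (direction (sin \<theta>, d * sin \<theta> - cos \<theta>)) (pi / 2) \<ge> e" "e > 0"
  shows "\<bar>d - cot \<theta>\<bar> \<le> pi / (2 * e)"
proof -
  define v where "v = (sin \<theta>, d * sin \<theta> - cos \<theta>)"
  define t where "t = direction v"
  have "v \<noteq> 0" using sin_cos_not_both_0 by (simp add: v_def zero_prod_def)
  then obtain c where c: "c \<noteq> 0" "t \<in> proj_line" "v = c *\<^sub>R unit_vec t"
    unfolding t_def by (rule direction_cases)
  have t: "\<bar>pi / 2 - t\<bar> \<ge> e" "\<bar>pi / 2 - t\<bar> \<le> pi / 2"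
    using assms(1) c(2) ang_dist_vertical[OF c(2)]
    by (simp_all add: t_def[symmetric] v_def[symmetric] proj_line_def abs_minus_commute) (simp add: abs_if)
  have "2 / pi * e \<le> 2 / pi * \<bar>pi / 2 - t\<bar>" using t by (intro mult_left_mono) auto
  also have "\<dots> \<le> sin \<bar>pi / 2 - t\<bar>" using t by (intro jordan_sin) auto
  also have "\<dots> \<le> \<bar>cos t\<bar>" by (cases "pi / 2 \<ge> t") (simp_all add: sin_diff)
  finally have ct: "2 / pi * e \<le> \<bar>cos t\<bar>" .
  have "0 < 2 / pi * e" using assms by simp
  then have ct0: "0 < \<bar>cos t\<bar>" using ct by linarith
  have eq: "sin \<theta> = c * cos t" "d * sin \<theta> - cos \<theta> = c * sin t"
    using c(3) by (auto simp: v_def unit_vec_def)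
  \<comment> \<open>A horizontal vector would be sent to the vertical one, which the distance
    \<open>e\<close> excludes. So the slope \<open>tan t = d - cot \<theta>\<close> of the image is
    finite.\<close>
  have s: "sin \<theta> \<noteq> 0" using eq c ct0 by auto
  have "d - cot \<theta> = (d * sin \<theta> - cos \<theta>) / sin \<theta>" using s by (simp add: cot_def field_simps)
  also have "\<dots> = sin t / cos t" using eq c by simp
  finally have "\<bar>d - cot \<theta>\<bar> = \<bar>sin t\<bar> / \<bar>cos t\<bar>" by simp
  also have "\<dots> \<le> 1 / (2 / pi * e)" using ct assms by (intro frac_le) auto
  finally show ?thesis by simp
qed

section \<open>Stationary measures of the inverse process\<close>

lemma circle_prob: "prob_space circle"
  by (rule prob_spaceI) (simp add: circle_def emeasure_restrict_space space_restrict_space)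

lemma sets_circle_circle: "sets (circle \<Otimes>\<^sub>M circle) = sets (restrict_space borel torus)"
proof -
  have sp: "space (circle \<Otimes>\<^sub>M circle) = torus" "space (restrict_space borel torus) = torus"
    by (auto simp: space_pair_measure torus_def space_restrict_space)
  have 1: "(\<lambda>p. p) \<in> (circle \<Otimes>\<^sub>M circle) \<rightarrow>\<^sub>M restrict_space borel torus"
  proof (rule measurable_restrict_space2)
    have "(\<lambda>p. (fst p, snd p)) \<in> (circle \<Otimes>\<^sub>M circle) \<rightarrow>\<^sub>M (borel :: (real \<times> real) measure)"
      by (intro borel_measurable_Pair) measurable
    then show "(\<lambda>p. p) \<in> (circle \<Otimes>\<^sub>M circle) \<rightarrow>\<^sub>M (borel :: (real \<times> real) measure)" by simp
  qed (auto simp: space_pair_measure torus_def)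
  have [measurable]: "(fst :: real \<times> real \<Rightarrow> real) \<in> borel_measurable borel"
      "(snd :: real \<times> real \<Rightarrow> real) \<in> borel_measurable borel"
    by (intro borel_measurable_continuous_onI continuous_intros)+
  have 2: "(\<lambda>p. p) \<in> restrict_space borel torus \<rightarrow>\<^sub>M (circle \<Otimes>\<^sub>M circle)"
  proof (rule measurable_pair)
    have b: "(\<lambda>p. p) \<in> borel_measurable (restrict_space borel torus)" by (rule measurable_restrict_space1) simp
    show "fst \<circ> (\<lambda>p. p) \<in> restrict_space borel torus \<rightarrow>\<^sub>M circle"
      "snd \<circ> (\<lambda>p. p) \<in> restrict_space borel torus \<rightarrow>\<^sub>M circle"
      using measurable_compose[OF b, of fst borel] measurable_compose[OF b, of snd borel]
      by (auto simp: measurable_circle_iff space_restrict_space torus_def comp_def)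
  qed
  show ?thesis
  proof (intro equalityI subsetI)
    fix A assume A: "A \<in> sets (circle \<Otimes>\<^sub>M circle)"
    from measurable_sets[OF 2 A] sets.sets_into_space[OF A] show "A \<in> sets (restrict_space borel torus)"
      by (simp add: sp Int_absorb2)
  next
    fix A assume A: "A \<in> sets (restrict_space borel torus)"
    from measurable_sets[OF 1 A] sets.sets_into_space[OF A] show "A \<in> sets (circle \<Otimes>\<^sub>M circle)"
      by (simp add: sp Int_absorb2)
  qed
qed

lemma torus_measure_eq: "torus_measure = circle \<Otimes>\<^sub>M circle"
proof (rule sym, rule pair_measure_eqI)
  interpret prob_space circle by (rule circle_prob)
  show "sigma_finite_measure circle" by unfold_locales
  then show "sigma_finite_measure circle" .
  show "sets (circle \<Otimes>\<^sub>M circle) = sets torus_measure"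
    unfolding torus_measure_def sets_circle_circle by (rule sets_restrict_space_cong) simp
  fix A B assume AB: "A \<in> sets circle" "B \<in> sets circle"
  have "torus \<in> sets lborel" unfolding torus_def by (simp add: borel_Times)
  then have "emeasure torus_measure (A \<times> B) = emeasure (lborel \<Otimes>\<^sub>M lborel) (A \<times> B)"
    unfolding torus_measure_def lborel_prod using sets_circleD[OF AB(1)] sets_circleD[OF AB(2)]
    by (intro emeasure_restrict_space) (auto simp: torus_def)
  also have "\<dots> = emeasure circle A * emeasure circle B"
    using sets_circleD[OF AB(1)] sets_circleD[OF AB(2)]
    by (simp add: lborel.emeasure_pair_measure_Times emeasure_circle AB)
  finally show "emeasure circle A * emeasure circle B = emeasure torus_measure (A \<times> B)" by simp
qed

lemma sets_proj_bundle: "sets proj_bundle = sets ((circle \<Otimes>\<^sub>M circle) \<Otimes>\<^sub>M proj_line_space)"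
  unfolding proj_bundle_def by (intro sets_pair_measure_cong sets_circle_circle[symmetric] refl)

lemma space_proj_bundle: "space proj_bundle = torus \<times> proj_line"
  by (simp add: proj_bundle_def space_pair_measure proj_line_space_def space_restrict_space)

lemma measurable_proj_bundle_iff:
  "f \<in> M \<rightarrow>\<^sub>M proj_bundle \<longleftrightarrow> f \<in> M \<rightarrow>\<^sub>M ((circle \<Otimes>\<^sub>M circle) \<Otimes>\<^sub>M proj_line_space)"
  by (rule measurable_cong_sets[OF refl sets_proj_bundle, THEN set_eq_iff[THEN iffD1, rule_format]])

lemma measurable_proj_line_space_iff:
  "g \<in> M \<rightarrow>\<^sub>M proj_line_space \<longleftrightarrow> g \<in> borel_measurable M \<and> g \<in> space M \<rightarrow> proj_line"
  by (auto simp: proj_line_space_def measurable_restrict_space2_iff)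

lemma measurable_proj_line_borel [measurable (raw)]:
  "g \<in> M \<rightarrow>\<^sub>M proj_line_space \<Longrightarrow> g \<in> borel_measurable M"
  by (simp add: measurable_proj_line_space_iff)

text \<open>Stated for images of unit vectors under the inverse derivative: these are never zero,
  and at zero \<open>direction\<close> would not be determined.\<close>

lemma measurable_direction [measurable (raw)]:
  assumes "\<theta> \<in> borel_measurable M" "d \<in> borel_measurable M"
  shows "(\<lambda>x. direction (sin (\<theta> x), d x * sin (\<theta> x) - cos (\<theta> x))) \<in> M \<rightarrow>\<^sub>M proj_line_space"
proof -
  note [measurable] = assms
  let ?a = "\<lambda>x. sin (\<theta> x)" and ?b = "\<lambda>x. d x * sin (\<theta> x) - cos (\<theta> x)"
  have "(\<lambda>x. if ?a x = 0 then pi / 2 else if ?b x / ?a x \<ge> 0 then arctan (?b x / ?a x) else arctan (?b x / ?a x) + pi)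
     \<in> borel_measurable M"
    by measurable
  then show ?thesis
    using direction_polar(1)[OF sin_cos_not_both_0] direction_polar(2)[OF sin_cos_not_both_0]
    by (simp add: measurable_proj_line_space_iff)
qed

lemma measurable_std_f [measurable]: "std_f L \<in> borel_measurable borel"
  unfolding std_f_def[abs_def] by measurable

lemma measurable_deriv_std_f [measurable]: "deriv (std_f L) \<in> borel_measurable borel"
  unfolding deriv_std_f[abs_def] by measurable

section \<open>The noise law and the kernel of the inverse projective process\<close>

context
  fixes L \<delta> :: real
  assumes L: "L > 0"
begin

lemma noise_width_pos: "noise_width L \<delta> > 0"
  using L by (simp add: noise_width_def)

lemma sets_noise: "sets (noise L \<delta>) = sets (restrict_space borel {- noise_width L \<delta> .. noise_width L \<delta>})"
  unfolding noise_def Let_def by (rule sets_restrict_space_cong) simp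

lemma space_noise: "space (noise L \<delta>) = {- noise_width L \<delta> .. noise_width L \<delta>}"
  unfolding noise_def Let_def by (simp add: space_restrict_space)

lemma noise_prob: "prob_space (noise L \<delta>)"
  unfolding noise_def Let_def using noise_width_pos
  by (intro prob_space_restrict_space emeasure_uniform_measure_1) auto

lemma measurable_noise_borel [measurable (raw)]: "g \<in> M \<rightarrow>\<^sub>M noise L \<delta> \<Longrightarrow> g \<in> borel_measurable M"
  unfolding measurable_cong_sets[OF refl sets_noise] by (auto simp: measurable_restrict_space2_iff)

lemma emeasure_noise:
  assumes "A \<in> sets (noise L \<delta>)"
  shows "emeasure (noise L \<delta>) A = emeasure lborel A / ennreal (2 * noise_width L \<delta>)"
proof -
  let ?I = "{- noise_width L \<delta> .. noise_width L \<delta>}"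
  have A: "A \<in> sets borel" "A \<subseteq> ?I"
    using assms sets.sets_into_space[OF assms] by (auto simp: sets_noise sets_restrict_space_iff space_noise)
  have "emeasure (noise L \<delta>) A = emeasure (uniform_measure lborel ?I) A"
    unfolding noise_def Let_def using A by (intro emeasure_restrict_space) auto
  also have "\<dots> = emeasure lborel (?I \<inter> A) / emeasure lborel ?I"
    using A by (intro emeasure_uniform_measure) auto
  also have "?I \<inter> A = A" using A by auto
  finally show ?thesis using noise_width_pos by simp
qed

lemma measurable_inv_proj_step:
  "(\<lambda>(p, w). inv_proj_step L w p) \<in> proj_bundle \<Otimes>\<^sub>M noise L \<delta> \<rightarrow>\<^sub>M proj_bundle"
proof -
  let ?f = "\<lambda>q. ((frac (snd (fst (fst q)) - snd q), frac (std_f L (snd (fst (fst q))) - fst (fst (fst q)))),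
      direction (sin (snd (fst q)), deriv (std_f L) (snd (fst (fst q))) * sin (snd (fst q)) - cos (snd (fst q))))"
  have "?f \<in> ((circle \<Otimes>\<^sub>M circle) \<Otimes>\<^sub>M proj_line_space) \<Otimes>\<^sub>M noise L \<delta> \<rightarrow>\<^sub>M ((circle \<Otimes>\<^sub>M circle) \<Otimes>\<^sub>M proj_line_space)"
    by measurable
  moreover have "?f = (\<lambda>(p, w). inv_proj_step L w p)"
    by (auto simp: inv_proj_step_eq)
  ultimately show ?thesis
    using measurable_cong_sets[OF sets_pair_measure_cong[OF sets_proj_bundle refl] sets_proj_bundle]
    by auto
qed

lemma measurable_inv_proj_step' [measurable (raw)]:
  assumes "g \<in> M \<rightarrow>\<^sub>M proj_bundle" "h \<in> M \<rightarrow>\<^sub>M noise L \<delta>"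
  shows "(\<lambda>x. inv_proj_step L (h x) (g x)) \<in> M \<rightarrow>\<^sub>M proj_bundle"
  using measurable_compose[OF measurable_Pair[OF assms] measurable_inv_proj_step] by simp

text \<open>The kernel equation as a fixed point of a push-forward from
  \<open>\<nu> \<Otimes>\<^sub>M noise L \<delta>\<close>, the form in which fresh independent noise
  is visible.\<close>

lemma stationary_iff:
  "stationary L \<delta> \<nu> \<longleftrightarrow> prob_space \<nu> \<and> sets \<nu> = sets proj_bundle \<and>
     distr (\<nu> \<Otimes>\<^sub>M noise L \<delta>) proj_bundle (\<lambda>(p, w). inv_proj_step L w p) = \<nu>"
proof -
  have "(\<forall>A\<in>sets proj_bundle. emeasure \<nu> A = (\<integral>\<^sup>+ p. emeasure (inv_proj_kernel L \<delta> p) A \<partial>\<nu>)) \<longleftrightarrow>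
      distr (\<nu> \<Otimes>\<^sub>M noise L \<delta>) proj_bundle (\<lambda>(p, w). inv_proj_step L w p) = \<nu>"
    if \<nu>: "prob_space \<nu>" and s: "sets \<nu> = sets proj_bundle"
  proof -
    interpret N: prob_space "noise L \<delta>" by (rule noise_prob)
    have m [measurable]: "(\<lambda>(p, w). inv_proj_step L w p) \<in> \<nu> \<Otimes>\<^sub>M noise L \<delta> \<rightarrow>\<^sub>M proj_bundle"
      using measurable_inv_proj_step measurable_cong_sets[OF sets_pair_measure_cong[OF s refl] refl] by blast
    have sp: "space \<nu> = space proj_bundle" using s by (rule sets_eq_imp_space_eq)
    have *: "emeasure (distr (\<nu> \<Otimes>\<^sub>M noise L \<delta>) proj_bundle (\<lambda>(p, w). inv_proj_step L w p)) A
        = (\<integral>\<^sup>+ p. emeasure (inv_proj_kernel L \<delta> p) A \<partial>\<nu>)" if A [measurable]: "A \<in> sets proj_bundle" for A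
    proof -
      have "emeasure (distr (\<nu> \<Otimes>\<^sub>M noise L \<delta>) proj_bundle (\<lambda>(p, w). inv_proj_step L w p)) A
        = emeasure (\<nu> \<Otimes>\<^sub>M noise L \<delta>) ((\<lambda>(p, w). inv_proj_step L w p) -` A \<inter> space (\<nu> \<Otimes>\<^sub>M noise L \<delta>))"
        by (rule emeasure_distr[OF m A])
      also have "\<dots> = (\<integral>\<^sup>+ p. emeasure (noise L \<delta>) (Pair p -` ((\<lambda>(p, w). inv_proj_step L w p) -` A \<inter> space (\<nu> \<Otimes>\<^sub>M noise L \<delta>))) \<partial>\<nu>)"
        by (rule N.emeasure_pair_measure_alt) (rule measurable_sets[OF m A])
      also have "\<dots> = (\<integral>\<^sup>+ p. emeasure (inv_proj_kernel L \<delta> p) A \<partial>\<nu>)"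
      proof (rule nn_integral_cong)
        fix p assume p: "p \<in> space \<nu>"
        have "(\<lambda>w. inv_proj_step L w p) \<in> noise L \<delta> \<rightarrow>\<^sub>M proj_bundle"
          using p by (intro measurable_inv_proj_step') (auto simp: sp)
        then show "emeasure (noise L \<delta>) (Pair p -` ((\<lambda>(p, w). inv_proj_step L w p) -` A \<inter> space (\<nu> \<Otimes>\<^sub>M noise L \<delta>)))
            = emeasure (inv_proj_kernel L \<delta> p) A"
          unfolding inv_proj_kernel_def using p
          by (subst emeasure_distr[OF _ A]) (auto simp: space_pair_measure intro!: arg_cong2[of _ _ _ _ emeasure])
      qed
      finally show ?thesis .
    qed
    show ?thesis using * s by (metis measure_eqI sets_distr)
  qed
  then show ?thesis unfolding stationary_def by blast
qed

lemma stationary_nn_integral: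
  assumes st: "stationary L \<delta> \<nu>" and f: "f \<in> borel_measurable proj_bundle"
  shows "(\<integral>\<^sup>+p. f p \<partial>\<nu>) = (\<integral>\<^sup>+p. \<integral>\<^sup>+w. f (inv_proj_step L w p) \<partial>noise L \<delta> \<partial>\<nu>)"
proof -
  interpret N: prob_space "noise L \<delta>" by (rule noise_prob)
  note [measurable] = f
  have s: "sets \<nu> = sets proj_bundle" using st by (simp add: stationary_def)
  have m [measurable]: "(\<lambda>(p, w). inv_proj_step L w p) \<in> \<nu> \<Otimes>\<^sub>M noise L \<delta> \<rightarrow>\<^sub>M proj_bundle"
    using measurable_inv_proj_step measurable_cong_sets[OF sets_pair_measure_cong[OF s refl] refl] by blast
  have "(\<integral>\<^sup>+p. f p \<partial>\<nu>) = (\<integral>\<^sup>+p. f p \<partial>distr (\<nu> \<Otimes>\<^sub>M noise L \<delta>) proj_bundle (\<lambda>(p, w). inv_proj_step L w p))"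
    using st by (simp add: stationary_iff)
  also have "\<dots> = (\<integral>\<^sup>+q. f (case q of (p, w) \<Rightarrow> inv_proj_step L w p) \<partial>(\<nu> \<Otimes>\<^sub>M noise L \<delta>))"
    by (rule nn_integral_distr[OF m]) simp
  also have "\<dots> = (\<integral>\<^sup>+p. \<integral>\<^sup>+w. f (inv_proj_step L w p) \<partial>noise L \<delta> \<partial>\<nu>)"
    by (subst N.nn_integral_fst[symmetric]) (auto intro: measurable_compose[OF m f])
  finally show ?thesis .
qed

text \<open>The angle \<open>\<theta>\<^sub>2\<close> after two steps does not depend on the noise, whereas \<open>y\<^sub>2\<close> depends on the
  initial point and \<open>w\<^sub>0\<close> alone, so that \<open>f'(y\<^sub>2)\<close> is spread out independently of \<open>\<theta>\<^sub>2\<close>.\<close>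
lemma three_steps_far:
  assumes e: "e > 0"
  shows "\<exists>c b. \<forall>w0 w1 w2. ang_dist (snd (inv_proj_step L w2 (inv_proj_step L w1 (inv_proj_step L w0 p)))) (pi / 2) \<ge> e
    \<longrightarrow> \<bar>sin (2 * pi * (w0 + c)) - b\<bar> \<le> 1 / (4 * L * e)"
proof -
  obtain x y \<theta> where p: "p = ((x, y), \<theta>)" by (metis surj_pair)
  define y1 where "y1 = frac (std_f L y - x)"
  define \<theta>1 where "\<theta>1 = direction (sin \<theta>, deriv (std_f L) y * sin \<theta> - cos \<theta>)"
  define \<theta>2 where "\<theta>2 = direction (sin \<theta>1, deriv (std_f L) y1 * sin \<theta>1 - cos \<theta>1)"
  \<comment> \<open>Neither \<open>y1\<close> nor the two angles involve noise, and
    \<open>y2\<close> is \<open>w0 + c\<close> modulo 1.\<close>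
  define c where "c = std_f L y1 - y"
  show ?thesis
  proof (intro exI allI impI)
    fix w0 w1 w2
    assume a: "ang_dist (snd (inv_proj_step L w2 (inv_proj_step L w1 (inv_proj_step L w0 p)))) (pi / 2) \<ge> e"
    define y2 where "y2 = frac (std_f L y1 - frac (y - w0))"
    have "inv_proj_step L w1 (inv_proj_step L w0 p) = ((frac (y1 - w1), y2), \<theta>2)"
      by (simp add: p inv_proj_step_eq y1_def y2_def \<theta>1_def \<theta>2_def)
    then have "ang_dist (direction (sin \<theta>2, deriv (std_f L) y2 * sin \<theta>2 - cos \<theta>2)) (pi / 2) \<ge> e"
      using a by (simp add: inv_proj_step_eq)
    then have "\<bar>deriv (std_f L) y2 - cot \<theta>2\<bar> \<le> pi / (2 * e)"
      using e by (rule direction_far_from_vertical)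
    moreover have "deriv (std_f L) y2 = - 2 * pi * L * sin (2 * pi * (w0 + c))"
      unfolding deriv_std_f y2_def frac_diff_frac sin_2pi_frac by (simp add: c_def algebra_simps)
    ultimately have "\<bar>- 2 * pi * L * sin (2 * pi * (w0 + c)) - cot \<theta>2\<bar> \<le> pi / (2 * e)" by simp
    also have "- 2 * pi * L * sin (2 * pi * (w0 + c)) - cot \<theta>2
        = - (2 * pi * L) * (sin (2 * pi * (w0 + c)) - (- cot \<theta>2 / (2 * pi * L)))"
      using L by (simp add: distrib_left)
    finally have "2 * pi * L * \<bar>sin (2 * pi * (w0 + c)) - (- cot \<theta>2 / (2 * pi * L))\<bar> \<le> pi / (2 * e)"
      using L by (simp add: abs_mult)
    \<comment> \<open>The band width is the slope bound \<open>pi / (2 * e)\<close> divided by the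
      amplitude \<open>2 * pi * L\<close> of the derivative of \<open>std_f L\<close>.\<close>
    then show "\<bar>sin (2 * pi * (w0 + c)) - (- cot \<theta>2 / (2 * pi * L))\<bar> \<le> 1 / (4 * L * e)"
      using L e by (simp add: field_simps)
  qed
qed

text \<open>Stationarity replaces the event by its probability after three steps, which is small
  from every starting point. The hypothesis \<open>\<sigma>\<close> puts the noise inside
  \<open>{-1..1}\<close>, where \<open>sin_band_measure\<close> gives 10 times a square root;
  division by the interval length leaves the factor 5.\<close>

lemma stationary_far_bound:
  assumes st: "stationary L \<delta> \<nu>" and e: "e > 0" and \<sigma>: "noise_width L \<delta> \<le> 1"
  shows "measure \<nu> {p \<in> space \<nu>. ang_dist (snd p) (pi / 2) \<ge> e}
    \<le> 5 * sqrt (1 / (4 * L * e)) / noise_width L \<delta>"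
proof -
  interpret N: prob_space "noise L \<delta>" by (rule noise_prob)
  interpret \<nu>: prob_space \<nu> using st by (simp add: stationary_def)
  have s: "sets \<nu> = sets proj_bundle" using st by (simp add: stationary_def)
  have sp: "space \<nu> = space proj_bundle" using s by (rule sets_eq_imp_space_eq)
  let ?N = "noise L \<delta>"
  let ?A = "{p \<in> space proj_bundle. ang_dist (snd p) (pi / 2) \<ge> e}"
  define B where "B = 5 * sqrt (1 / (4 * L * e)) / noise_width L \<delta>"
  have B0: "0 \<le> B" using noise_width_pos L e by (simp add: B_def)
  have [measurable]: "snd \<in> borel_measurable proj_bundle"
    unfolding proj_bundle_def by measurable
  have [measurable]: "(\<lambda>\<theta>. ang_dist \<theta> (pi / 2)) \<in> borel_measurable borel"
    unfolding ang_dist_def by measurable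
  have A [measurable]: "?A \<in> sets proj_bundle" by measurable
  define g where "g = (\<lambda>p. indicator ?A p :: ennreal)"
  have [measurable]: "g \<in> borel_measurable proj_bundle" unfolding g_def by measurable
  \<comment> \<open>\<open>T\<close> is the transition operator; integrals against \<nu> are
    unchanged under it.\<close>
  define T where "T f p = (\<integral>\<^sup>+w. f (inv_proj_step L w p) \<partial>?N)" for f :: "(real \<times> real) \<times> real \<Rightarrow> ennreal" and p
  have T [measurable]: "T f \<in> borel_measurable proj_bundle" if [measurable]: "f \<in> borel_measurable proj_bundle" for f
    unfolding T_def[abs_def] by measurable
  have I: "(\<integral>\<^sup>+p. f p \<partial>\<nu>) = (\<integral>\<^sup>+p. T f p \<partial>\<nu>)" if "f \<in> borel_measurable proj_bundle" for f
    using stationary_nn_integral[OF st that] by (simp add: T_def)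
  have bound: "T (T (T g)) p \<le> B" for p
  proof -
    obtain c b where cb: "\<And>w0 w1 w2. ang_dist (snd (inv_proj_step L w2 (inv_proj_step L w1 (inv_proj_step L w0 p)))) (pi / 2) \<ge> e
      \<Longrightarrow> \<bar>sin (2 * pi * (w0 + c)) - b\<bar> \<le> 1 / (4 * L * e)"
      using three_steps_far[OF e] by metis
    let ?S = "{w \<in> {-1..1}. \<bar>sin (2 * pi * (w + c)) - b\<bar> \<le> 1 / (4 * L * e)}"
    let ?S' = "{w \<in> space ?N. \<bar>sin (2 * pi * (w + c)) - b\<bar> \<le> 1 / (4 * L * e)}"
    have S' [measurable]: "?S' \<in> sets ?N" by measurable
    \<comment> \<open>After three steps the event forces a condition on \<open>w0\<close> alone, so
      the two inner integrals are trivial.\<close>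
    have "T (T (T g)) p \<le> (\<integral>\<^sup>+w0. \<integral>\<^sup>+w1. \<integral>\<^sup>+w2. indicator ?S' w0 \<partial>?N \<partial>?N \<partial>?N)"
      unfolding T_def by (intro nn_integral_mono) (auto simp: g_def indicator_def dest: cb)
    also have "\<dots> = emeasure ?N ?S'" by (simp add: N.emeasure_space_1)
    also have "\<dots> = emeasure lborel ?S' / ennreal (2 * noise_width L \<delta>)" by (rule emeasure_noise[OF S'])
    also have "\<dots> \<le> emeasure lborel ?S / ennreal (2 * noise_width L \<delta>)"
      using \<sigma> by (intro divide_right_mono_ennreal emeasure_mono) (auto simp: space_noise)
    also have "\<dots> \<le> ennreal (10 * sqrt (1 / (4 * L * e))) / ennreal (2 * noise_width L \<delta>)"
      using L e by (intro divide_right_mono_ennreal sin_band_measure) auto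
    also have "\<dots> = ennreal B"
      using L e noise_width_pos by (simp add: divide_ennreal B_def)
    finally show ?thesis .
  qed
  have "emeasure \<nu> ?A = (\<integral>\<^sup>+p. g p \<partial>\<nu>)" using A by (simp add: g_def s)
  also have "\<dots> = (\<integral>\<^sup>+p. T (T (T g)) p \<partial>\<nu>)" by (simp add: I[symmetric])
  also have "\<dots> \<le> (\<integral>\<^sup>+p. ennreal B \<partial>\<nu>)" by (intro nn_integral_mono bound)
  also have "\<dots> = ennreal B" by (simp add: \<nu>.emeasure_space_1)
  finally have "measure \<nu> ?A \<le> B" using B0 by (simp add: \<nu>.emeasure_eq_measure)
  then show ?thesis by (simp add: B_def sp)
qed

end

lemma stationary_far_set:
  assumes "stationary L \<delta> \<nu>"
  shows "{p \<in> space \<nu>. snd p \<notin> proj_ball \<phi> r} = {p \<in> space \<nu>. ang_dist (snd p) \<phi> \<ge> r}"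
proof -
  have "sets \<nu> = sets proj_bundle" using assms unfolding stationary_def by blast
  then have "space \<nu> = torus \<times> proj_line" unfolding space_proj_bundle[symmetric] by (rule sets_eq_imp_space_eq)
  then have "snd p \<in> proj_line" if "p \<in> space \<nu>" for p using that mem_Times_iff[of p] by (simp only:)
  then show ?thesis by (intro Collect_cong conj_cong refl) (simp add: proj_ball_def not_less)
qed

text \<open>With \<open>e = L powr (- (1 / 4))\<close> the square root, which is the price of the
  turning points of the sine, is at most \<open>L powr (- (3 / 8))\<close>. Dividing by the noise
  width costs at most \<open>L powr (1 / 8)\<close>, and the factor 5 is absorbed by another
  \<open>L powr (1 / 8)\<close> once \<open>5 ^ 8 \<le> L\<close>. What remains is
  \<open>L powr (- (1 / 8))\<close>.\<close>

lemma stationary_bound_exists: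
  assumes "0 < \<delta>" "\<delta> < 1 / 8"
  shows "stationary_bound \<delta> (1 / 4) (1 / 8)"
  unfolding stationary_bound_def
proof (intro eventually_mono[OF eventually_ge_at_top[of "(5 :: real) ^ 8"]] allI impI)
  fix L :: real and \<nu> assume L: "5 ^ 8 \<le> L" and st: "stationary L \<delta> \<nu>"
  have L1: "L > 1" using L by simp
  have w: "noise_width L \<delta> \<le> 1" unfolding noise_width_def
    using powr_mono[of "- \<delta>" 0 L] L1 assms by simp
  have "5 = ((5 :: real) powr 8) powr (1 / 8)" by (simp only: powr_powr) simp
  also have "\<dots> \<le> L powr (1 / 8)" using L by (intro powr_mono2) (simp_all add: powr_numeral)
  finally have five: "5 \<le> L powr (1 / 8)" .
  have "measure \<nu> {p \<in> space \<nu>. snd p \<notin> proj_ball (pi / 2) (L powr (- (1 / 4)))}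
      \<le> 5 * sqrt (1 / (4 * L * L powr (- (1 / 4)))) / noise_width L \<delta>"
    unfolding stationary_far_set[OF st] using L1 w st by (intro stationary_far_bound) auto
  also have "\<dots> \<le> L powr (1 / 8) * L powr (- (3 / 8)) / L powr (- (1 / 8))"
  proof (intro frac_le mult_mono five)
    have "1 / (4 * L * L powr (- (1 / 4))) \<le> 1 / (L powr 1 * L powr (- (1 / 4)))"
      using L1 by (intro frac_le) auto
    also have "\<dots> = L powr (- (3 / 4))"
      unfolding powr_add[symmetric] powr_minus_divide[of L "3 / 4"] by simp
    also have "\<dots> = (L powr (- (3 / 8)))\<^sup>2" using L1 by (simp add: power2_eq_square powr_add[symmetric])
    finally show "sqrt (1 / (4 * L * L powr (- (1 / 4)))) \<le> L powr (- (3 / 8))"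
      by (intro real_le_lsqrt) auto
    show "L powr (- (1 / 8)) \<le> noise_width L \<delta>"
      unfolding noise_width_def using L1 assms by (intro powr_mono) auto
  qed (use L1 in auto)
  also have "\<dots> = L powr (- (1 / 8))" using L1 by (simp add: powr_add[symmetric] powr_diff[symmetric])
  finally show "measure \<nu> {p \<in> space \<nu>. snd p \<notin> proj_ball (pi / 2) (L powr - (1 / 4))} \<le> L powr - (1 / 8)" .
qed

section \<open>Skew product and law of the stable direction\<close>

lemma nn_integral_circle_rotate:
  "g \<in> borel_measurable circle \<Longrightarrow> (\<integral>\<^sup>+x. g (frac (x + a)) \<partial>circle) = (\<integral>\<^sup>+x. g x \<partial>circle)"
  using nn_integral_distr[of "\<lambda>x. frac (x + a)" circle circle g] by (simp add: distr_circle_rotate)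

lemma nn_integral_circle_reflect:
  "g \<in> borel_measurable circle \<Longrightarrow> (\<integral>\<^sup>+x. g (frac (a - x)) \<partial>circle) = (\<integral>\<^sup>+x. g x \<partial>circle)"
  using nn_integral_distr[of "\<lambda>x. frac (a - x)" circle circle g] by (simp add: distr_circle_reflect)

lemma std_map_eq: "std_map L w z = (frac (std_f L (fst z + w) - snd z), frac (fst z + w))"
  by (cases z) (simp add: std_map_def std_lift_def mod1_def)

lemma measurable_torus_fst_snd [measurable (raw)]:
  assumes "g \<in> M \<rightarrow>\<^sub>M torus_measure"
  shows "(\<lambda>x. fst (g x)) \<in> borel_measurable M" "(\<lambda>x. snd (g x)) \<in> borel_measurable M"
  using assms unfolding torus_measure_eq by measurable

lemma measurable_std_map [measurable (raw)]:
  assumes [measurable]: "g \<in> M \<rightarrow>\<^sub>M torus_measure" "h \<in> borel_measurable M"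
  shows "(\<lambda>x. std_map L (h x) (g x)) \<in> M \<rightarrow>\<^sub>M torus_measure"
  unfolding std_map_eq by (subst torus_measure_eq) measurable

lemma torus_prob: "prob_space torus_measure"
proof -
  interpret pair_prob_space circle circle
    by (simp add: pair_prob_space_def pair_sigma_finite_def prob_space_imp_sigma_finite circle_prob)
  show ?thesis unfolding torus_measure_eq by unfold_locales
qed

lemma space_torus_measure: "space torus_measure = torus"
  by (simp add: torus_measure_def space_restrict_space)

text \<open>For fixed \<open>x\<close> the map reflects the \<open>y\<close> circle; after
  exchanging the integrals what is left is a rotation in \<open>x\<close>.\<close>

lemma nn_integral_std_map:
  assumes [measurable]: "f \<in> borel_measurable torus_measure"
  shows "(\<integral>\<^sup>+z. f (std_map L w z) \<partial>torus_measure) = (\<integral>\<^sup>+z. f z \<partial>torus_measure)"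
proof -
  interpret C: prob_space circle by (rule circle_prob)
  interpret CC: pair_sigma_finite circle circle by unfold_locales
  have f [measurable]: "f \<in> borel_measurable (circle \<Otimes>\<^sub>M circle)"
    using assms by (simp add: torus_measure_eq)
  have "(\<lambda>z. f (std_map L w z)) \<in> borel_measurable torus_measure" by measurable
  then have m: "(\<lambda>z. f (std_map L w z)) \<in> borel_measurable (circle \<Otimes>\<^sub>M circle)"
    by (simp add: torus_measure_eq)
  have "(\<integral>\<^sup>+z. f (std_map L w z) \<partial>torus_measure)
      = (\<integral>\<^sup>+x. \<integral>\<^sup>+y. f (frac (std_f L (x + w) - y), frac (x + w)) \<partial>circle \<partial>circle)"
    unfolding torus_measure_eq by (subst C.nn_integral_fst[symmetric, OF m]) (simp add: std_map_eq)
  also have "\<dots> = (\<integral>\<^sup>+x. \<integral>\<^sup>+y. f (y, frac (x + w)) \<partial>circle \<partial>circle)"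
  proof (rule nn_integral_cong)
    fix x assume "x \<in> space circle"
    show "(\<integral>\<^sup>+y. f (frac (std_f L (x + w) - y), frac (x + w)) \<partial>circle) = (\<integral>\<^sup>+y. f (y, frac (x + w)) \<partial>circle)"
      by (rule nn_integral_circle_reflect[where g="\<lambda>y. f (y, frac (x + w))"]) (simp add: frac_lt_1)
  qed
  also have "\<dots> = (\<integral>\<^sup>+y. \<integral>\<^sup>+x. f (y, frac (x + w)) \<partial>circle \<partial>circle)"
    by (rule CC.Fubini'[symmetric]) measurable
  also have "\<dots> = (\<integral>\<^sup>+y. \<integral>\<^sup>+x. f (y, x) \<partial>circle \<partial>circle)"
    by (intro nn_integral_cong nn_integral_circle_rotate) simp
  also have "\<dots> = (\<integral>\<^sup>+z. f z \<partial>torus_measure)"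
    unfolding torus_measure_eq by (rule C.nn_integral_fst) simp
  finally show ?thesis .
qed

context
  fixes L \<delta> :: real
  assumes L: "L > 0"
begin

private abbreviation (input) "N \<equiv> noise L \<delta>"
private abbreviation (input) "S \<equiv> noise_seq L \<delta>"
private abbreviation (input) "M \<equiv> S \<Otimes>\<^sub>M torus_measure"

lemma noise_seq_prob: "prob_space (noise_seq L \<delta>)"
  unfolding noise_seq_def by (rule prob_space_PiM) (rule noise_prob[OF L])

lemma noise_torus_prob: "prob_space (noise_seq L \<delta> \<Otimes>\<^sub>M torus_measure)"
proof -
  interpret pair_prob_space S torus_measure
    by (simp add: pair_prob_space_def pair_sigma_finite_def prob_space_imp_sigma_finite noise_seq_prob torus_prob)
  show ?thesis by unfold_locales
qed

lemma measurable_noise_coord [measurable]: "(\<lambda>\<omega>. \<omega> n) \<in> noise_seq L \<delta> \<rightarrow>\<^sub>M noise L \<delta>"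
  unfolding noise_seq_def by measurable

lemma measurable_noise_shift [measurable]: "(\<lambda>\<omega> n. \<omega> (Suc n)) \<in> noise_seq L \<delta> \<rightarrow>\<^sub>M noise_seq L \<delta>"
  unfolding noise_seq_def by (rule measurable_PiM_single') (auto simp: space_PiM PiE_iff)

lemma skew_eq: "skew L q = (\<lambda>n. fst q (Suc n), std_map L (fst q 0) (snd q))"
  by (simp add: skew_def case_prod_beta)

lemma measurable_skew [measurable]:
  "skew L \<in> noise_seq L \<delta> \<Otimes>\<^sub>M torus_measure \<rightarrow>\<^sub>M noise_seq L \<delta> \<Otimes>\<^sub>M torus_measure"
  unfolding skew_eq[abs_def] using measurable_noise_borel[OF L] by measurable

text \<open>Says that \<open>skew L q\<close> and \<open>fst q 0\<close> are independent, with the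
  invariant law and the noise law. For each fixed first noise the torus map preserves area, and the
  shifted sequence is independent of the first coordinate.\<close>

lemma nn_integral_skew_noise:
  assumes F [measurable]: "F \<in> borel_measurable ((noise_seq L \<delta> \<Otimes>\<^sub>M torus_measure) \<Otimes>\<^sub>M noise L \<delta>)"
  shows "(\<integral>\<^sup>+q. F (skew L q, fst q 0) \<partial>(noise_seq L \<delta> \<Otimes>\<^sub>M torus_measure)) =
     (\<integral>\<^sup>+q. \<integral>\<^sup>+w. F (q, w) \<partial>noise L \<delta> \<partial>(noise_seq L \<delta> \<Otimes>\<^sub>M torus_measure))"
proof -
  interpret N: prob_space N by (rule noise_prob[OF L])
  interpret T: prob_space torus_measure by (rule torus_prob)
  interpret S: prob_space S by (rule noise_seq_prob)
  interpret M: prob_space M by (rule noise_torus_prob)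
  interpret NM: pair_sigma_finite M N by unfold_locales
  interpret SS: sequence_space N by unfold_locales
  have nb [measurable (raw)]: "g \<in> borel_measurable K" if "g \<in> K \<rightarrow>\<^sub>M N" for g and K :: "'b measure"
    using measurable_noise_borel[OF L that] .
  define H where "H p = (\<integral>\<^sup>+z. F ((snd p, z), fst p) \<partial>torus_measure)" for p
  have [measurable]: "H \<in> borel_measurable (N \<Otimes>\<^sub>M S)"
    unfolding H_def[abs_def] by measurable
  have "(\<integral>\<^sup>+q. F (skew L q, fst q 0) \<partial>M) = (\<integral>\<^sup>+\<omega>. \<integral>\<^sup>+z. F (skew L (\<omega>, z), \<omega> 0) \<partial>torus_measure \<partial>S)"
    by (subst T.nn_integral_fst[symmetric]) simp_all
  also have "\<dots> = (\<integral>\<^sup>+\<omega>. H (\<omega> 0, \<lambda>n. \<omega> (Suc n)) \<partial>S)"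
  proof (rule nn_integral_cong)
    fix \<omega> assume w: "\<omega> \<in> space S"
    have [simp]: "(\<lambda>n. \<omega> (Suc n)) \<in> space S" "\<omega> 0 \<in> space N"
      using measurable_space[OF measurable_noise_shift w] measurable_space[OF measurable_noise_coord w] by auto
    have "(\<lambda>z. F ((\<lambda>n. \<omega> (Suc n), z), \<omega> 0)) \<in> borel_measurable torus_measure" by measurable
    from nn_integral_std_map[OF this, of L "\<omega> 0"]
    show "(\<integral>\<^sup>+z. F (skew L (\<omega>, z), \<omega> 0) \<partial>torus_measure) = H (\<omega> 0, \<lambda>n. \<omega> (Suc n))"
      by (simp add: skew_eq H_def)
  qed
  \<comment> \<open>Prepending an independent coordinate to a noise sequence reproduces its
    law.\<close>
  also have "\<dots> = (\<integral>\<^sup>+\<omega>. H (\<omega> 0, \<lambda>n. \<omega> (Suc n)) \<partial>distr (N \<Otimes>\<^sub>M S) S (\<lambda>(s, \<omega>). case_nat s \<omega>))"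
    using SS.PiM_iter by (simp add: noise_seq_def)
  also have "\<dots> = (\<integral>\<^sup>+p. H p \<partial>(N \<Otimes>\<^sub>M S))"
  proof -
    have "(\<lambda>(s, \<omega>). case_nat s \<omega>) \<in> N \<Otimes>\<^sub>M S \<rightarrow>\<^sub>M S" unfolding noise_seq_def by measurable
    then show ?thesis by (subst nn_integral_distr) (simp_all add: case_prod_beta)
  qed
  also have "\<dots> = (\<integral>\<^sup>+w. \<integral>\<^sup>+\<omega>. \<integral>\<^sup>+z. F ((\<omega>, z), w) \<partial>torus_measure \<partial>S \<partial>N)"
    by (subst S.nn_integral_fst[symmetric]) (simp_all add: H_def)
  also have "\<dots> = (\<integral>\<^sup>+w. \<integral>\<^sup>+q. F (q, w) \<partial>M \<partial>N)"
  proof (rule nn_integral_cong)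
    fix w assume "w \<in> space N"
    then have "(\<lambda>q. F (q, w)) \<in> borel_measurable M" by measurable
    then show "(\<integral>\<^sup>+\<omega>. \<integral>\<^sup>+z. F ((\<omega>, z), w) \<partial>torus_measure \<partial>S) = (\<integral>\<^sup>+q. F (q, w) \<partial>M)"
      by (rule T.nn_integral_fst)
  qed
  also have "\<dots> = (\<integral>\<^sup>+q. \<integral>\<^sup>+w. F (q, w) \<partial>N \<partial>M)" by (rule NM.Fubini[OF F])
  finally show ?thesis .
qed

lemma distr_skew: "distr (noise_seq L \<delta> \<Otimes>\<^sub>M torus_measure) (noise_seq L \<delta> \<Otimes>\<^sub>M torus_measure) (skew L)
    = noise_seq L \<delta> \<Otimes>\<^sub>M torus_measure"
proof (rule measure_eqI)
  interpret N: prob_space N by (rule noise_prob[OF L])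
  fix A assume "A \<in> sets (distr M M (skew L))"
  then have A [measurable]: "A \<in> sets M" by simp
  have "emeasure (distr M M (skew L)) A = (\<integral>\<^sup>+q. indicator A q \<partial>distr M M (skew L))" by simp
  also have "\<dots> = (\<integral>\<^sup>+q. indicator A (skew L q) \<partial>M)" by (rule nn_integral_distr) auto
  also have "\<dots> = (\<integral>\<^sup>+q. \<integral>\<^sup>+w. indicator A q \<partial>N \<partial>M)"
    using nn_integral_skew_noise[of "\<lambda>(q, w). indicator A q"] by simp
  also have "\<dots> = emeasure M A" by (simp add: N.emeasure_space_1)
  finally show "emeasure (distr M M (skew L)) A = emeasure M A" .
qed simp

section \<open>The joint law of base point and stable direction\<close>

context
  fixes es :: "(nat \<Rightarrow> real) \<times> (real \<times> real) \<Rightarrow> real"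
  assumes es: "oseledets_stable L \<delta> es"
begin

lemma measurable_es [measurable]: "es \<in> noise_seq L \<delta> \<Otimes>\<^sub>M torus_measure \<rightarrow>\<^sub>M proj_line_space"
  using es by (simp add: oseledets_stable_def)

lemma measurable_graph_es [measurable]:
  "(\<lambda>q. (snd q, es q)) \<in> noise_seq L \<delta> \<Otimes>\<^sub>M torus_measure \<rightarrow>\<^sub>M proj_bundle"
  unfolding measurable_proj_bundle_iff torus_measure_eq[symmetric] by measurable

text \<open>Invariance under \<open>skew L\<close> transports the almost sure stability of
  \<open>es\<close> to the image point, so it holds at \<open>q\<close> and at
  \<open>skew L q\<close> simultaneously.\<close>

lemma AE_es_pullback:
  "AE q in noise_seq L \<delta> \<Otimes>\<^sub>M torus_measure.
     inv_proj_step L (fst q 0) (snd (skew L q), es (skew L q)) = (snd q, es q)"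
proof -
  have 1: "AE q in M. stable_at L (fst q) (snd q) (es q)"
    using es by (simp add: oseledets_stable_def case_prod_beta)
  then have "AE q in distr M M (skew L). stable_at L (fst q) (snd q) (es q)"
    by (simp only: distr_skew)
  then have 2: "AE q in M. stable_at L (fst (skew L q)) (snd (skew L q)) (es (skew L q))"
    by (rule AE_distrD[OF measurable_skew])
  have 3: "AE q in M. snd q \<in> torus"
    by (rule AE_I2) (auto simp: space_pair_measure space_torus_measure)
  from 1 2 3 show ?thesis
  proof eventually_elim
    case (elim q)
    then show ?case
      using stable_at_pullback[of "snd q" L "fst q" "es q" "es (skew L q)"] by (simp add: skew_eq)
  qed
qed

text \<open>Invariance of \<open>E\<close> makes \<open>q \<in> E\<close> a condition on \<open>skew L q\<close>, which is independent of the
  noise \<open>fst q 0\<close> of the inverse step leading back to \<open>q\<close>.\<close>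
lemma stationary_es:
  assumes E [measurable]: "E \<in> sets (noise_seq L \<delta> \<Otimes>\<^sub>M torus_measure)"
    and inv: "skew L -` E \<inter> space (noise_seq L \<delta> \<Otimes>\<^sub>M torus_measure) = E"
    and pos: "emeasure (noise_seq L \<delta> \<Otimes>\<^sub>M torus_measure) E \<noteq> 0"
  shows "stationary L \<delta>
    (distr (uniform_measure (noise_seq L \<delta> \<Otimes>\<^sub>M torus_measure) E) proj_bundle (\<lambda>q. (snd q, es q)))"
    (is "stationary L \<delta> ?\<nu>")
proof -
  interpret N: prob_space N by (rule noise_prob[OF L])
  interpret M: prob_space M by (rule noise_torus_prob)
  let ?p = "\<lambda>q. (snd q, es q)"
  have p [measurable]: "?p \<in> uniform_measure M E \<rightarrow>\<^sub>M proj_bundle" by simp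
  have \<nu>: "prob_space ?\<nu>"
    by (intro prob_space.prob_space_distr prob_space_uniform_measure pos) (simp_all add: M.emeasure_eq_measure)
  have step [measurable (raw)]: "(\<lambda>x. inv_proj_step L (h x) (g x)) \<in> K \<rightarrow>\<^sub>M proj_bundle"
    if "g \<in> K \<rightarrow>\<^sub>M proj_bundle" "h \<in> K \<rightarrow>\<^sub>M N" for g h and K :: "'b measure"
    by (rule measurable_inv_proj_step'[OF L that])
  have s: "(\<lambda>(p, w). inv_proj_step L w p) \<in> ?\<nu> \<Otimes>\<^sub>M N \<rightarrow>\<^sub>M proj_bundle"
    using measurable_inv_proj_step[OF L] measurable_cong_sets[OF sets_pair_measure_cong[OF sets_distr refl] refl] by blast
  have "distr (?\<nu> \<Otimes>\<^sub>M N) proj_bundle (\<lambda>(p, w). inv_proj_step L w p) = ?\<nu>"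
  proof (rule measure_eqI)
    fix A assume "A \<in> sets (distr (?\<nu> \<Otimes>\<^sub>M N) proj_bundle (\<lambda>(p, w). inv_proj_step L w p))"
    then have A [measurable]: "A \<in> sets proj_bundle" by simp
    \<comment> \<open>Both factors are read at the skew image; composing with
      \<open>(skew L q, fst q 0)\<close> returns them to \<open>q\<close>, the first by the pullback
      of \<open>es\<close>, the second by invariance of \<open>E\<close>.\<close>
    define F where "F = (\<lambda>(q, w). indicator A (inv_proj_step L w (?p q)) * indicator E q :: ennreal)"
    have F [measurable]: "F \<in> borel_measurable (M \<Otimes>\<^sub>M N)" unfolding F_def by measurable
    have "emeasure (distr (?\<nu> \<Otimes>\<^sub>M N) proj_bundle (\<lambda>(p, w). inv_proj_step L w p)) A
        = (\<integral>\<^sup>+x. indicator A x \<partial>distr (?\<nu> \<Otimes>\<^sub>M N) proj_bundle (\<lambda>(p, w). inv_proj_step L w p))"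
      by simp
    also have "\<dots> = (\<integral>\<^sup>+x. indicator A (case x of (p, w) \<Rightarrow> inv_proj_step L w p) \<partial>(?\<nu> \<Otimes>\<^sub>M N))"
      by (rule nn_integral_distr[OF s]) simp
    also have "\<dots> = (\<integral>\<^sup>+p. \<integral>\<^sup>+w. indicator A (inv_proj_step L w p) \<partial>N \<partial>?\<nu>)"
      using measurable_compose[OF s, of "indicator A :: _ \<Rightarrow> ennreal" borel]
      by (subst N.nn_integral_fst[symmetric]) simp_all
    also have "\<dots> = (\<integral>\<^sup>+q. \<integral>\<^sup>+w. indicator A (inv_proj_step L w (?p q)) \<partial>N \<partial>uniform_measure M E)"
      by (rule nn_integral_distr[OF p]) measurable
    also have "\<dots> = (\<integral>\<^sup>+q. (\<integral>\<^sup>+w. indicator A (inv_proj_step L w (?p q)) \<partial>N) * indicator E q \<partial>M) / emeasure M E"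
      by (rule nn_integral_uniform_measure) measurable
    also have "(\<integral>\<^sup>+q. (\<integral>\<^sup>+w. indicator A (inv_proj_step L w (?p q)) \<partial>N) * indicator E q \<partial>M)
        = (\<integral>\<^sup>+q. \<integral>\<^sup>+w. F (q, w) \<partial>N \<partial>M)"
      unfolding F_def by (intro nn_integral_cong) (simp add: nn_integral_multc)
    also have "\<dots> = (\<integral>\<^sup>+q. F (skew L q, fst q 0) \<partial>M)" by (rule nn_integral_skew_noise[OF F, symmetric])
    also have "\<dots> = (\<integral>\<^sup>+q. indicator A (?p q) * indicator E q \<partial>M)"
    proof (rule nn_integral_cong_AE)
      have "AE q in M. skew L q \<in> E \<longleftrightarrow> q \<in> E" using inv by (intro AE_I2) auto
      with AE_es_pullback show "AE q in M. F (skew L q, fst q 0) = indicator A (?p q) * indicator E q"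
        by eventually_elim (simp add: F_def indicator_def)
    qed
    also have "\<dots> / emeasure M E = (\<integral>\<^sup>+q. indicator A (?p q) \<partial>uniform_measure M E)"
      by (rule nn_integral_uniform_measure[symmetric]) simp_all
    also have "\<dots> = (\<integral>\<^sup>+x. indicator A x \<partial>?\<nu>)" by (rule nn_integral_distr[OF p, symmetric]) simp
    also have "\<dots> = emeasure ?\<nu> A" by simp
    finally show "emeasure (distr (?\<nu> \<Otimes>\<^sub>M N) proj_bundle (\<lambda>(p, w). inv_proj_step L w p)) A = emeasure ?\<nu> A" .
  qed simp
  then show ?thesis unfolding stationary_iff[OF L] using \<nu> by simp
qed

text \<open>The bound for the stationary law conditioned on \<open>E\<close>, multiplied by the
  measure of \<open>E\<close>. A null \<open>E\<close> admits no conditioning, but both sides are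
  then zero.\<close>

lemma es_far_bound_on_invariant:
  assumes bound: "\<And>\<nu>. stationary L \<delta> \<nu> \<Longrightarrow> measure \<nu> {p \<in> space \<nu>. snd p \<notin> proj_ball (pi / 2) \<epsilon>} \<le> c"
    and E: "E \<in> sets (noise_seq L \<delta> \<Otimes>\<^sub>M torus_measure)"
    and inv: "skew L -` E \<inter> space (noise_seq L \<delta> \<Otimes>\<^sub>M torus_measure) = E"
  shows "measure (noise_seq L \<delta> \<Otimes>\<^sub>M torus_measure)
      (E \<inter> {q \<in> space (noise_seq L \<delta> \<Otimes>\<^sub>M torus_measure). ang_dist (es q) (pi / 2) \<ge> \<epsilon>})
    \<le> c * measure (noise_seq L \<delta> \<Otimes>\<^sub>M torus_measure) E"
    (is "measure M (E \<inter> ?B) \<le> _")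
proof (cases "emeasure M E = 0")
  interpret M: prob_space M by (rule noise_torus_prob)
  case True
  then have 0: "measure M E = 0" by (simp add: measure_def)
  have "measure M (E \<inter> ?B) \<le> measure M E" using E by (intro M.finite_measure_mono) auto
  then show ?thesis unfolding 0 by simp
next
  interpret M: prob_space M by (rule noise_torus_prob)
  case False
  let ?p = "\<lambda>q. (snd q, es q)"
  let ?\<nu> = "distr (uniform_measure M E) proj_bundle ?p"
  have st: "stationary L \<delta> ?\<nu>" by (rule stationary_es[OF E inv False])
  let ?A = "{p \<in> space proj_bundle. ang_dist (snd p) (pi / 2) \<ge> \<epsilon>}"
  have [measurable]: "snd \<in> borel_measurable proj_bundle"
    unfolding proj_bundle_def by measurable
  have [measurable]: "(\<lambda>\<theta>. ang_dist \<theta> (pi / 2)) \<in> borel_measurable borel"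
    unfolding ang_dist_def by measurable
  have A: "?A \<in> sets proj_bundle" by measurable
  have B: "?B \<in> sets M" by measurable
  have pB: "?p -` ?A \<inter> space (uniform_measure M E) = ?B"
    using measurable_space[OF measurable_graph_es] by auto
  have "measure M (E \<inter> ?B) / measure M E = measure (uniform_measure M E) ?B"
    using False E B by (intro measure_uniform_measure[symmetric]) (simp_all add: M.emeasure_eq_measure)
  also have "\<dots> = measure ?\<nu> ?A"
    unfolding pB[symmetric] by (rule measure_distr[symmetric]) (use A in simp_all)
  also have "\<dots> \<le> c" using bound[OF st] unfolding stationary_far_set[OF st] by simp
  finally show ?thesis using False by (simp add: M.emeasure_eq_measure field_simps zero_less_measure_iff)
qed

text \<open>The whole space as invariant event gives the first bound; letting the event vary gives
  the hypothesis of \<open>birkhoff_limsup_bound\<close> and thereby the second.\<close>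

lemma es_far_bounds:
  assumes bound: "\<And>\<nu>. stationary L \<delta> \<nu> \<Longrightarrow> measure \<nu> {p \<in> space \<nu>. snd p \<notin> proj_ball (pi / 2) \<epsilon>} \<le> c"
  shows "measure (noise_seq L \<delta> \<Otimes>\<^sub>M torus_measure)
      {q \<in> space (noise_seq L \<delta> \<Otimes>\<^sub>M torus_measure). ang_dist (es q) (pi / 2) \<ge> \<epsilon>} \<le> c" (is ?thesis1)
    and "AE q in noise_seq L \<delta> \<Otimes>\<^sub>M torus_measure.
      limsup (\<lambda>n. ereal (real (card {k \<in> {1..n}. ang_dist (es ((skew L ^^ k) q)) (pi / 2) \<ge> \<epsilon>}) / real n))
        \<le> ereal c" (is ?thesis2)
proof -
  interpret M: prob_space M by (rule noise_torus_prob)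
  let ?B = "{q \<in> space M. ang_dist (es q) (pi / 2) \<ge> \<epsilon>}"
  have [measurable]: "(\<lambda>\<theta>. ang_dist \<theta> (pi / 2)) \<in> borel_measurable borel"
    unfolding ang_dist_def by measurable
  have B: "?B \<in> sets M" by measurable
  have "skew L -` space M \<inter> space M = space M" using measurable_space[OF measurable_skew] by auto
  from es_far_bound_on_invariant[OF bound sets.top this] show ?thesis1
    by (simp add: M.prob_space Int_absorb1 Collect_conj_eq[symmetric] Int_def)
  have "AE q in M. limsup (\<lambda>n. ereal (real (card {k \<in> {1..n}. (skew L ^^ k) q \<in> ?B}) / real n)) \<le> ereal c"
    by (rule birkhoff_limsup_bound[OF M.finite_measure_axioms measurable_skew distr_skew B])
      (rule es_far_bound_on_invariant[OF bound])
  then show ?thesis2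
    using AE_space
  proof eventually_elim
    case (elim q)
    have "(skew L ^^ k) q \<in> space M" for k
      using elim(2) measurable_space[OF measurable_skew] by (induction k) auto
    then show ?case using elim(1) by simp
  qed
qed

end
end

theorem corollary6p5:
  "\<exists>\<delta>\<^sub>0 > 0. \<forall>\<delta>. 0 < \<delta> \<and> \<delta> < \<delta>\<^sub>0 \<longrightarrow>
     (\<exists>s > 0. \<exists>r > 0. stationary_bound \<delta> s r) \<and>
     (\<forall>s > 0. \<forall>r > 0. stationary_bound \<delta> s r \<longrightarrow>
        (\<forall>\<^sub>F L in at_top. \<forall>es. oseledets_stable L \<delta> es \<longrightarrow>
           measure (noise_seq L \<delta> \<Otimes>\<^sub>M torus_measure)
             {q \<in> space (noise_seq L \<delta> \<Otimes>\<^sub>M torus_measure).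
                ang_dist (es q) (pi / 2) \<ge> L powr (- s)} \<le> L powr (- r) \<and>
           (AE q in noise_seq L \<delta> \<Otimes>\<^sub>M torus_measure.
              limsup (\<lambda>n. ereal (real (card {k \<in> {1..n}.
                  ang_dist (es ((skew L ^^ k) q)) (pi / 2) \<ge> L powr (- s)}) / real n))
              \<le> ereal (L powr (- r)))))"
proof (rule exI[of _ "1 / 8"], intro conjI allI impI)
  fix \<delta> :: real assume "0 < \<delta> \<and> \<delta> < 1 / 8"
  then have "stationary_bound \<delta> (1 / 4) (1 / 8)" by (intro stationary_bound_exists) auto
  then show "\<exists>s > 0. \<exists>r > 0. stationary_bound \<delta> s r"
    by (intro exI[of _ "1 / 4"] exI[of _ "1 / 8"] conjI) simp_all
next
  fix \<delta> s r :: real assume "stationary_bound \<delta> s r"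
  then have "\<forall>\<^sub>F L in at_top. \<forall>\<nu>. stationary L \<delta> \<nu> \<longrightarrow>
      measure \<nu> {p \<in> space \<nu>. snd p \<notin> proj_ball (pi / 2) (L powr (- s))} \<le> L powr (- r)"
    by (simp add: stationary_bound_def)
  \<comment> \<open>Positivity of \<open>L\<close> makes the noise interval nondegenerate and the
    noise a probability measure.\<close>
  with eventually_gt_at_top[of 0]
  show "\<forall>\<^sub>F L in at_top. \<forall>es. oseledets_stable L \<delta> es \<longrightarrow>
           measure (noise_seq L \<delta> \<Otimes>\<^sub>M torus_measure)
             {q \<in> space (noise_seq L \<delta> \<Otimes>\<^sub>M torus_measure).
                ang_dist (es q) (pi / 2) \<ge> L powr (- s)} \<le> L powr (- r) \<and>
           (AE q in noise_seq L \<delta> \<Otimes>\<^sub>M torus_measure.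
              limsup (\<lambda>n. ereal (real (card {k \<in> {1..n}.
                  ang_dist (es ((skew L ^^ k) q)) (pi / 2) \<ge> L powr (- s)}) / real n))
              \<le> ereal (L powr (- r)))"
  proof eventually_elim
    case (elim L)
    then show ?case using es_far_bounds[of L \<delta> _ "L powr (- s)" "L powr (- r)"] by blast
  qed
qed simp

end
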